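(* Let $Q$ be a smooth manifold and $h\in C^\infty(T^*Q\times\mathbb R\times\mathbb R)$ a (possibly time-dependent) contact Hamiltonian, with associated 1-form $\eta^E$ and time-dependent contact Hamiltonian vector field $X_h^t$. Let $F\in C^\infty(T^*Q\times\mathbb R\times\mathbb R)$ be a dissipated quantity. Then the most general generalized Noether symmetry associated with $F$ is $$Y_F=X_F+Y^t\,X_h^t,$$ where $X_F$ is the contact Hamiltonian vector field of $F$ and $Y^t\in C^\infty(T^*Q\times\mathbb R\times\mathbb R)$ is an arbitrary function. That is, a vector field $Y$ on $T^*Q\times\mathbb R\times\mathbb R$ is a generalized Noether symmetry with $-\iota_Y\eta^E=F$ if and only if $Y=X_F+Y^tX_h^t$ for some smooth function $Y^t$.
   Context: Everything is smooth; $\mathfrak L$ denotes the Lie derivative and $\iota$ the interior product. Let $Q$ be a manifold, $\alpha$ the Liouville 1-form on $T^*Q$ (locally $\alpha=p_a dq^a$, summation over repeated indices). The contact phase space is $T^*Q\times\mathbb R$ with contact form $\eta=dS-\alpha$ (pullback understood), $S$ the coordinate on $\mathbb R$; its Reeb vector field is $R=\partial_S$. The extended contact phase space is $T^*Q\times\mathbb R\times\mathbb R$, with $t$ the coordinate on the last factor, endowed with the 1-form $\eta^E=\eta+h\,dt$ (pullback of $\eta$ understood), where $h$ is a smooth function of $(q,p,S,t)$. Here $R(h)=\partial h/\partial S$. For a smooth function $F$ of $(q,p,S,t)$, the contact Hamiltonian vector field $X_F$ is the vector field with no $\partial_t$ component whose restriction to each slice $t=\text{const}$ is determined by $\iota_{X_F}d\eta=dF-R(F)\eta$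 and $\iota_{X_F}\eta=-F$ on $T^*Q\times\mathbb R$; in coordinates $X_F=\frac{\partial F}{\partial p_a}\partial_{q^a}-\left(\frac{\partial F}{\partial q^a}+p_a\frac{\partial F}{\partial S}\right)\partial_{p_a}+\left(p_a\frac{\partial F}{\partial p_a}-F\right)\partial_S$. The time-dependent contact Hamiltonian vector field of $h$ is $X_h^t=X_h+\partial_t$; it satisfies $\iota_{X_h^t}d\eta^E=-R(h)\eta^E$ and $\iota_{X_h^t}\eta^E=0$. A generalized Noether symmetry is a vector field $Y$ on $T^*Q\times\mathbb R\times\mathbb R$ with $\mathfrak L_Y\eta^E=\lambda\,\eta^E$ for some $\lambda\in C^\infty(T^*Q\times\mathbb R\times\mathbb R)$; it is associated with $F$ if $-\iota_Y\eta^E=F$. A dissipated quantity is a function $F:T^*Q\times\mathbb R\times\mathbb R\to\mathbb R$ with $\mathfrak L_{X_h^t}F=-R(h)F$. *)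

theory Defs
  imports "HOL-Analysis.Analysis"
begin

section \<open>Smooth maps between finite-dimensional spaces\<close>

text \<open>
  Only used on open subsets of finite-dimensional spaces, where continuity of all iterated
  directional derivatives is the usual notion of being of class \<open>C\<^sup>k\<close>.
\<close>

primrec Ck_on :: "nat \<Rightarrow> 'a::real_normed_vector set \<Rightarrow> ('a \<Rightarrow> 'b::real_normed_vector) \<Rightarrow> bool" where
  "Ck_on 0 S f \<longleftrightarrow> continuous_on S f"
| "Ck_on (Suc k) S f \<longleftrightarrow>
     (\<forall>x\<in>S. f differentiable (at x)) \<and>
     (\<forall>v. Ck_on k S (\<lambda>x. frechet_derivative f (at x) v))"

definition smooth_on :: "'a::real_normed_vector set \<Rightarrow> ('a \<Rightarrow> 'b::real_normed_vector) \<Rightarrow> bool" where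
  "smooth_on S f \<longleftrightarrow> (\<forall>k. Ck_on k S f)"


section \<open>Smooth manifolds\<close>

text \<open>
  A chart is a pair of a domain and a coordinate map; values of the coordinate map outside the
  domain are irrelevant. The model space is a finite-dimensional real inner product space (rather
  than a type of class \<^class>\<open>euclidean_space\<close>, which would exclude dimension zero). The inner
  product only serves to write linear functionals on the model space as vectors.
\<close>

type_synonym ('m, 'e) chart = "'m set \<times> ('m \<Rightarrow> 'e)"

definition chart_inv :: "('m, 'e) chart \<Rightarrow> 'e \<Rightarrow> 'm" where
  "chart_inv c = inv_into (fst c) (snd c)"

definition smooth_manifold :: "'m topology \<Rightarrow> ('m, 'e::real_inner) chart set \<Rightarrow> bool" where
  "smooth_manifold X A \<longleftrightarrow>
     (\<exists>B :: 'e set. finite B \<and> span B = UNIV) \<and>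
     Hausdorff_space X \<and> second_countable X \<and>
     (\<Union>c\<in>A. fst c) = topspace X \<and>
     (\<forall>c\<in>A. openin X (fst c) \<and> open (snd c ` fst c) \<and>
        homeomorphic_map (subtopology X (fst c)) (top_of_set (snd c ` fst c)) (snd c)) \<and>
     (\<forall>c\<in>A. \<forall>c'\<in>A. smooth_on (snd c ` (fst c \<inter> fst c')) (snd c' \<circ> chart_inv c))"

definition points :: "('m, 'e) chart set \<Rightarrow> 'm set" where
  "points A = (\<Union>c\<in>A. fst c)"

definition charts_at :: "('m, 'e) chart set \<Rightarrow> 'm \<Rightarrow> ('m, 'e) chart set" where
  "charts_at A x = {c\<in>A. x \<in> fst c}"

text \<open>
  Some of the notions below are chart independent but are computed in one chart around the given
  point; this is the chart that is used.
\<close>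

definition chart_at :: "('m, 'e) chart set \<Rightarrow> 'm \<Rightarrow> ('m, 'e) chart" where
  "chart_at A x = (SOME c. c \<in> charts_at A x)"

definition smooth_fun :: "('m, 'e::real_normed_vector) chart set \<Rightarrow> ('m \<Rightarrow> real) \<Rightarrow> bool" where
  "smooth_fun A f \<longleftrightarrow> (\<forall>c\<in>A. smooth_on (snd c ` fst c) (f \<circ> chart_inv c))"


section \<open>Tangent vectors and vector fields\<close>

text \<open>
  A tangent vector at \<open>x\<close> assigns to each chart around \<open>x\<close> its components in that chart, such that
  the components are related by the Jacobians of the transition maps. It is set to \<open>0\<close> on all other
  arguments, so that equality of tangent vectors is equality of functions.
\<close>

type_synonym ('m, 'e) tvec = "('m, 'e) chart \<Rightarrow> 'e"

definition jacobian :: "('m, 'e::real_normed_vector) chart \<Rightarrow> ('m, 'e) chart \<Rightarrow> 'm \<Rightarrow> 'e \<Rightarrow> 'e" where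
  "jacobian c c' x = frechet_derivative (snd c' \<circ> chart_inv c) (at (snd c x))"

definition tangent_space :: "('m, 'e::real_normed_vector) chart set \<Rightarrow> 'm \<Rightarrow> ('m, 'e) tvec set" where
  "tangent_space A x =
     {v. (\<forall>c\<in>charts_at A x. \<forall>c'\<in>charts_at A x. v c' = jacobian c c' x (v c)) \<and>
         (\<forall>c. c \<notin> charts_at A x \<longrightarrow> v c = 0)}"

text \<open>The tangent vector at \<open>x\<close> whose components in the chart \<open>c\<close> are \<open>u\<close>.\<close>

definition coord_vec ::
  "('m, 'e::real_normed_vector) chart set \<Rightarrow> ('m, 'e) chart \<Rightarrow> 'm \<Rightarrow> 'e \<Rightarrow> ('m, 'e) tvec" where
  "coord_vec A c x u = (\<lambda>c'. if c' \<in> charts_at A x then jacobian c c' x u else 0)"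

definition vector_field ::
  "('m, 'e::real_normed_vector) chart set \<Rightarrow> ('m \<Rightarrow> ('m, 'e) tvec) \<Rightarrow> bool" where
  "vector_field A Y \<longleftrightarrow>
     (\<forall>x\<in>points A. Y x \<in> tangent_space A x) \<and>
     (\<forall>c\<in>A. smooth_on (snd c ` fst c) (\<lambda>y. Y (chart_inv c y) c))"

definition tangent_map ::
  "('m, 'e::real_normed_vector) chart set \<Rightarrow> ('n, 'f::real_normed_vector) chart set \<Rightarrow>
   ('m \<Rightarrow> 'n) \<Rightarrow> 'm \<Rightarrow> ('m, 'e) tvec \<Rightarrow> ('n, 'f) tvec" where
  "tangent_map A B f x v =
     (let c = chart_at A x in
      (\<lambda>c'. if c' \<in> charts_at B (f x)
            then frechet_derivative (snd c' \<circ> f \<circ> chart_inv c) (at (snd c x)) (v c) else 0))"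


section \<open>Differential forms\<close>

text \<open>A 1-form is a function of a point and a tangent vector at that point.\<close>

type_synonym ('m, 'e) form1 = "'m \<Rightarrow> ('m, 'e) tvec \<Rightarrow> real"

definition differential ::
  "('m, 'e::real_normed_vector) chart set \<Rightarrow> ('m \<Rightarrow> real) \<Rightarrow> ('m, 'e) form1" where
  "differential A f x v =
     (let c = chart_at A x in frechet_derivative (f \<circ> chart_inv c) (at (snd c x)) (v c))"

definition pullback ::
  "('m, 'e::real_normed_vector) chart set \<Rightarrow> ('n, 'f::real_normed_vector) chart set \<Rightarrow>
   ('m \<Rightarrow> 'n) \<Rightarrow> ('n, 'f) form1 \<Rightarrow> ('m, 'e) form1" where
  "pullback A B f \<omega> x v = \<omega> (f x) (tangent_map A B f x v)"

definition contract ::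
  "('m \<Rightarrow> ('m, 'e) tvec) \<Rightarrow> ('m, 'e) form1 \<Rightarrow> 'm \<Rightarrow> real" where
  "contract Y \<omega> x = \<omega> x (Y x)"

text \<open>Component of the 1-form \<open>\<omega>\<close> along the direction \<open>u\<close> in the chart \<open>c\<close>, at coordinates \<open>y\<close>.\<close>

definition form_comp ::
  "('m, 'e::real_normed_vector) chart set \<Rightarrow> ('m, 'e) form1 \<Rightarrow> ('m, 'e) chart \<Rightarrow> 'e \<Rightarrow> 'e \<Rightarrow> real" where
  "form_comp A \<omega> c y u = \<omega> (chart_inv c y) (coord_vec A c (chart_inv c y) u)"

text \<open>In coordinates, \<open>d\<omega>(v, w) = (\<partial>\<^sub>i \<omega>\<^sub>j - \<partial>\<^sub>j \<omega>\<^sub>i) v\<^sup>i w\<^sup>j\<close>.\<close>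

definition ext_deriv ::
  "('m, 'e::real_normed_vector) chart set \<Rightarrow> ('m, 'e) form1 \<Rightarrow>
   'm \<Rightarrow> ('m, 'e) tvec \<Rightarrow> ('m, 'e) tvec \<Rightarrow> real" where
  "ext_deriv A \<omega> x v w =
     (let c = chart_at A x in
        frechet_derivative (\<lambda>y. form_comp A \<omega> c y (w c)) (at (snd c x)) (v c)
      - frechet_derivative (\<lambda>y. form_comp A \<omega> c y (v c)) (at (snd c x)) (w c))"

text \<open>
  Lie derivatives along a vector field \<open>Y\<close>, of functions and of 1-forms. In coordinates,
  the latter is \<open>(Y\<^sup>i \<partial>\<^sub>i \<omega>\<^sub>j + \<omega>\<^sub>i \<partial>\<^sub>j Y\<^sup>i) w\<^sup>j\<close>.
\<close>

definition lie_fun ::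
  "('m, 'e::real_normed_vector) chart set \<Rightarrow> ('m \<Rightarrow> ('m, 'e) tvec) \<Rightarrow> ('m \<Rightarrow> real) \<Rightarrow> 'm \<Rightarrow> real" where
  "lie_fun A Y f x = differential A f x (Y x)"

definition lie_form ::
  "('m, 'e::real_normed_vector) chart set \<Rightarrow> ('m \<Rightarrow> ('m, 'e) tvec) \<Rightarrow> ('m, 'e) form1 \<Rightarrow> ('m, 'e) form1" where
  "lie_form A Y \<omega> x w =
     (let c = chart_at A x in
        frechet_derivative (\<lambda>y. form_comp A \<omega> c y (w c)) (at (snd c x)) (Y x c)
      + form_comp A \<omega> c (snd c x)
          (frechet_derivative (\<lambda>y. Y (chart_inv c y) c) (at (snd c x)) (w c)))"


section \<open>The cotangent bundle\<close>

text \<open>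
  Covectors at \<open>q\<close> are linear functionals on the tangent space at \<open>q\<close>, extended by \<open>0\<close> to
  functions on the whole type. Addition and scaling of tangent vectors are pointwise.
\<close>

type_synonym ('q, 'e) covec = "('q, 'e) tvec \<Rightarrow> real"

type_synonym ('q, 'e) cot = "'q \<times> ('q, 'e) covec"

definition cotangent_space :: "('q, 'e::real_normed_vector) chart set \<Rightarrow> 'q \<Rightarrow> ('q, 'e) covec set" where
  "cotangent_space A q =
     {\<xi>. (\<forall>v\<in>tangent_space A q. \<forall>w\<in>tangent_space A q. \<xi> (\<lambda>c. v c + w c) = \<xi> v + \<xi> w) \<and>
         (\<forall>r. \<forall>v\<in>tangent_space A q. \<xi> (\<lambda>c. r *\<^sub>R v c) = r * \<xi> v) \<and>
         (\<forall>v. v \<notin> tangent_space A q \<longrightarrow> \<xi> v = 0)}"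

text \<open>The vector of the components \<open>p\<^sub>a\<close> of a covector at \<open>q\<close> in the chart \<open>c\<close>.\<close>

definition covec_comp ::
  "('q, 'e::real_inner) chart set \<Rightarrow> ('q, 'e) chart \<Rightarrow> 'q \<Rightarrow> ('q, 'e) covec \<Rightarrow> 'e" where
  "covec_comp A c q \<xi> = (THE p. \<forall>u. \<xi> (coord_vec A c q u) = p \<bullet> u)"

definition cotangent_chart ::
  "('q, 'e::real_inner) chart set \<Rightarrow> ('q, 'e) chart \<Rightarrow> (('q, 'e) cot, 'e \<times> 'e) chart" where
  "cotangent_chart A c =
     (SIGMA q:fst c. cotangent_space A q, \<lambda>(q, \<xi>). (snd c q, covec_comp A c q \<xi>))"

definition cotangent_atlas ::
  "('q, 'e::real_inner) chart set \<Rightarrow> (('q, 'e) cot, 'e \<times> 'e) chart set" where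
  "cotangent_atlas A = cotangent_chart A ` A"

text \<open>The Liouville 1-form: \<open>\<alpha>\<close> at \<open>(q, \<xi>)\<close> is \<open>\<xi>\<close> composed with the differential of the projection.\<close>

definition liouville :: "('q, 'e::real_inner) chart set \<Rightarrow> (('q, 'e) cot, 'e \<times> 'e) form1" where
  "liouville A z v = snd z (tangent_map (cotangent_atlas A) A fst z v)"


section \<open>The extended contact phase space\<close>

text \<open>Its points are triples of a covector, a value of \<open>S\<close> and a value of \<open>t\<close>.\<close>

type_synonym ('q, 'e) phase = "('q, 'e) cot \<times> real \<times> real"

type_synonym 'e phase_model = "('e \<times> 'e) \<times> real \<times> real"

definition phase_atlas ::
  "('q, 'e::real_inner) chart set \<Rightarrow> (('q, 'e) phase, 'e phase_model) chart set" where
  "phase_atlas A = (\<lambda>c. (fst c \<times> UNIV, map_prod (snd c) id)) ` cotangent_atlas A"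

definition S_coord :: "('q, 'e) phase \<Rightarrow> real" where
  "S_coord z = fst (snd z)"

definition t_coord :: "('q, 'e) phase \<Rightarrow> real" where
  "t_coord z = snd (snd z)"

text \<open>The Reeb vector field and the vector field \<open>\<partial>\<^sub>t\<close>: the same components in every chart.\<close>

definition reeb :: "('q, 'e::real_inner) chart set \<Rightarrow>
    ('q, 'e) phase \<Rightarrow> (('q, 'e) phase, 'e phase_model) tvec" where
  "reeb A z = (\<lambda>c. if c \<in> charts_at (phase_atlas A) z then ((0, 0), (1, 0)) else 0)"

definition partial_t :: "('q, 'e::real_inner) chart set \<Rightarrow>
    ('q, 'e) phase \<Rightarrow> (('q, 'e) phase, 'e phase_model) tvec" where
  "partial_t A z = (\<lambda>c. if c \<in> charts_at (phase_atlas A) z then ((0, 0), (0, 1)) else 0)"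

text \<open>The pullback of the contact form \<open>dS - \<alpha>\<close> to the extended contact phase space.\<close>

definition contact_form :: "('q, 'e::real_inner) chart set \<Rightarrow>
    (('q, 'e) phase, 'e phase_model) form1" where
  "contact_form A z v =
     differential (phase_atlas A) S_coord z v
     - pullback (phase_atlas A) (cotangent_atlas A) fst (liouville A) z v"

definition ext_contact_form :: "('q, 'e::real_inner) chart set \<Rightarrow> (('q, 'e) phase \<Rightarrow> real) \<Rightarrow>
    (('q, 'e) phase, 'e phase_model) form1" where
  "ext_contact_form A h z v =
     contact_form A z v + h z * differential (phase_atlas A) t_coord z v"

text \<open>
  The tangent vectors annihilated by \<open>dt\<close> are those tangent to the slice \<open>t = const\<close>. On them, the
  defining equations of the contact Hamiltonian vector field on the slice are
  \<open>d\<eta>(X\<^sub>F, w) = dF(w) - R(F) \<eta>(w)\<close> and \<open>\<eta>(X\<^sub>F) = - F\<close>.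
\<close>

definition contact_hamiltonian_vf :: "('q, 'e::real_inner) chart set \<Rightarrow> (('q, 'e) phase \<Rightarrow> real) \<Rightarrow>
    ('q, 'e) phase \<Rightarrow> (('q, 'e) phase, 'e phase_model) tvec" where
  "contact_hamiltonian_vf A F z =
     (THE v. v \<in> tangent_space (phase_atlas A) z \<and>
        differential (phase_atlas A) t_coord z v = 0 \<and>
        contact_form A z v = - F z \<and>
        (\<forall>w\<in>tangent_space (phase_atlas A) z.
           differential (phase_atlas A) t_coord z w = 0 \<longrightarrow>
           ext_deriv (phase_atlas A) (contact_form A) z v w =
             differential (phase_atlas A) F z w
             - lie_fun (phase_atlas A) (reeb A) F z * contact_form A z w))"

definition evolution_vf :: "('q, 'e::real_inner) chart set \<Rightarrow> (('q, 'e) phase \<Rightarrow> real) \<Rightarrow>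
    ('q, 'e) phase \<Rightarrow> (('q, 'e) phase, 'e phase_model) tvec" where
  "evolution_vf A h z = (\<lambda>c. contact_hamiltonian_vf A h z c + partial_t A z c)"

definition dissipated_quantity :: "('q, 'e::real_inner) chart set \<Rightarrow>
    (('q, 'e) phase \<Rightarrow> real) \<Rightarrow> (('q, 'e) phase \<Rightarrow> real) \<Rightarrow> bool" where
  "dissipated_quantity A h F \<longleftrightarrow>
     (\<forall>z\<in>points (phase_atlas A).
        lie_fun (phase_atlas A) (evolution_vf A h) F z =
          - lie_fun (phase_atlas A) (reeb A) h z * F z)"

definition generalized_noether_symmetry :: "('q, 'e::real_inner) chart set \<Rightarrow>
    (('q, 'e) phase \<Rightarrow> real) \<Rightarrow>
    (('q, 'e) phase \<Rightarrow> (('q, 'e) phase, 'e phase_model) tvec) \<Rightarrow> bool" where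
  "generalized_noether_symmetry A h Y \<longleftrightarrow>
     vector_field (phase_atlas A) Y \<and>
     (\<exists>l. smooth_fun (phase_atlas A) l \<and>
        (\<forall>z\<in>points (phase_atlas A). \<forall>w\<in>tangent_space (phase_atlas A) z.
           lie_form (phase_atlas A) Y (ext_contact_form A h) z w = l z * ext_contact_form A h z w))"

definition associated_with :: "('q, 'e::real_inner) chart set \<Rightarrow> (('q, 'e) phase \<Rightarrow> real) \<Rightarrow>
    (('q, 'e) phase \<Rightarrow> (('q, 'e) phase, 'e phase_model) tvec) \<Rightarrow> (('q, 'e) phase \<Rightarrow> real) \<Rightarrow> bool" where
  "associated_with A h Y F \<longleftrightarrow>
     (\<forall>z\<in>points (phase_atlas A). - contract Y (ext_contact_form A h) z = F z)"

end

theory Submission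
  imports Defs
begin

text \<open>
  In a phase chart with coordinates \<open>(q, p, S, t)\<close>, Cartan's formula turns
  \<open>L\<^sub>Y \<eta>\<^sup>E = \<lambda> \<eta>\<^sup>E\<close> together with \<open>\<iota>\<^sub>Y \<eta>\<^sup>E = - F\<close> into \<open>\<iota>\<^sub>Y d\<eta>\<^sup>E - dF = \<lambda> \<eta>\<^sup>E\<close>, which is
  algebraic in \<open>Y\<close> at each point. Its \<open>S\<close> component gives
  \<open>\<lambda> = - (Y\<^sup>t R(h) + R(F))\<close> with \<open>Y\<^sup>t = dt(Y)\<close>, and its \<open>p\<close> and \<open>q\<close> components then give the \<open>q\<close>
  and \<open>p\<close> components of \<open>Y\<close>; the contraction condition gives the \<open>S\<close> component. Thus
  \<open>Y = X\<^sub>F + Y\<^sup>t X\<^sub>h\<^sup>t\<close>. For such a \<open>Y\<close> the remaining \<open>t\<close> component of the equation is exactly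
  the dissipation law of \<open>F\<close>.

  The coordinate expression of \<open>X\<^sub>F\<close> is available in every chart, so that \<open>X\<^sub>F\<close> is smooth, because
  \<open>d\<eta>\<close> computed in coordinates does not depend on the chart. Only differentiability of the
  transition maps of the phase space is needed for this, not their smoothness.
\<close>


section \<open>Calculus\<close>

text \<open>On an open set the values of a map determine its germ at every point, hence all iterated
  derivatives. The main use is to replace a derivative by a formula that holds on \<open>S\<close>
  only.\<close>

lemma Ck_on_cong:
  assumes "open S" "\<And>x. x \<in> S \<Longrightarrow> f x = g x" "Ck_on k S f"
  shows "Ck_on k S g"
  using assms(2,3)
proof (induction k arbitrary: f g)
  case 0
  then show ?case by (simp cong: continuous_on_cong)
next
  case (Suc k)
  have d: "f differentiable (at x)" if "x \<in> S" for x
    using Suc.prems(2) that by simp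
  have "frechet_derivative f (at x) = frechet_derivative g (at x)" if "x \<in> S" for x
    using frechet_derivative_transform_within_open[OF d[OF that] \<open>open S\<close> that Suc.prems(1)] by blast
  moreover have "g differentiable (at x)" if "x \<in> S" for x
    using has_derivative_transform_within_open[of f _ x UNIV S g] d[OF that] \<open>open S\<close> that Suc.prems(1)
    by (auto simp: differentiable_def)
  ultimately show ?case
    using Suc.prems(2) Suc.IH[of "\<lambda>x. frechet_derivative f (at x) v" "\<lambda>x. frechet_derivative g (at x) v" for v]
    by auto
qed

text \<open>The recursion peels off derivatives starting with the first, so lowering the order ends
  at differentiable maps being continuous. The product rule needs this, since each of its terms
  keeps one factor undifferentiated.\<close>

lemma Ck_on_Suc_imp: "Ck_on (Suc k) S f \<Longrightarrow> Ck_on k S f"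
proof (induction k arbitrary: f)
  case 0
  then show ?case
    by (auto intro!: continuous_at_imp_continuous_on differentiable_imp_continuous_within)
next
  case (Suc k)
  then show ?case by simp
qed

lemma Ck_on_const: "Ck_on k S (\<lambda>x. c)"
  by (induction k arbitrary: c) auto

lemma Ck_on_add:
  assumes "open S" "Ck_on k S f" "Ck_on k S g"
  shows "Ck_on k S (\<lambda>x. f x + g x)"
  using assms(2,3)
proof (induction k arbitrary: f g)
  case 0
  then show ?case by (auto intro: continuous_on_add)
next
  case (Suc k)
  have "Ck_on k S (\<lambda>x. frechet_derivative (\<lambda>x. f x + g x) (at x) v)" for v
  proof (rule Ck_on_cong[OF \<open>open S\<close>])
    show "Ck_on k S (\<lambda>x. frechet_derivative f (at x) v + frechet_derivative g (at x) v)"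
      using Suc by auto
    show "frechet_derivative f (at x) v + frechet_derivative g (at x) v =
        frechet_derivative (\<lambda>x. f x + g x) (at x) v" if "x \<in> S" for x
    proof -
      have "((\<lambda>x. f x + g x) has_derivative
          (\<lambda>v. frechet_derivative f (at x) v + frechet_derivative g (at x) v)) (at x)"
        using Suc.prems that by (intro has_derivative_add) (auto simp: frechet_derivative_works)
      from frechet_derivative_at[OF this] show ?thesis by metis
    qed
  qed
  then show ?case using Suc.prems by auto
qed

text \<open>By the Leibniz rule the derivative is a sum of two terms of the same bilinear shape, to
  which the induction hypothesis applies.\<close>

lemma Ck_on_bilinear:
  assumes "bounded_bilinear b" "open S" "Ck_on k S f" "Ck_on k S g"
  shows "Ck_on k S (\<lambda>x. b (f x) (g x))"
  using assms(3,4)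
proof (induction k arbitrary: f g)
  case 0
  then show ?case using assms(1) by (auto intro: bounded_bilinear.continuous_on)
next
  case (Suc k)
  have *: "((\<lambda>x. b (f x) (g x)) has_derivative
      (\<lambda>v. b (f x) (frechet_derivative g (at x) v) + b (frechet_derivative f (at x) v) (g x))) (at x)"
    if "x \<in> S" for x
    using Suc.prems that
    by (intro bounded_bilinear.FDERIV[OF assms(1)]) (auto simp: frechet_derivative_works)
  have "Ck_on k S (\<lambda>x. frechet_derivative (\<lambda>x. b (f x) (g x)) (at x) v)" for v
  proof (rule Ck_on_cong[OF \<open>open S\<close>])
    show "Ck_on k S (\<lambda>x. b (f x) (frechet_derivative g (at x) v) + b (frechet_derivative f (at x) v) (g x))"
      using Suc Ck_on_Suc_imp[OF Suc.prems(1)] Ck_on_Suc_imp[OF Suc.prems(2)]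
      by (intro Ck_on_add assms(2)) auto
    show "b (f x) (frechet_derivative g (at x) v) + b (frechet_derivative f (at x) v) (g x) =
        frechet_derivative (\<lambda>x. b (f x) (g x)) (at x) v" if "x \<in> S" for x
      using frechet_derivative_at[OF *[OF that]] by metis
  qed
  then show ?case using * by (auto simp: differentiable_def)
qed

lemma Ck_on_linear:
  assumes "bounded_linear f"
  shows "Ck_on k S f"
proof (cases k)
  case 0
  then show ?thesis using assms by (simp add: linear_continuous_on)
next
  case (Suc j)
  have "(f has_derivative f) (at x)" for x
    using assms by (rule bounded_linear_imp_has_derivative)
  then have "frechet_derivative f (at x) = f" for x
    by (metis frechet_derivative_at)
  then show ?thesis
    using Suc assms by (auto simp: Ck_on_const bounded_linear_imp_differentiable)
qed

section \<open>Closure properties of smooth maps\<close>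

lemma smooth_on_cong:
  assumes "open S" "\<And>x. x \<in> S \<Longrightarrow> f x = g x" "smooth_on S f"
  shows "smooth_on S g"
  using assms Ck_on_cong unfolding smooth_on_def by blast

lemma smooth_on_const: "smooth_on S (\<lambda>x. c)"
  by (simp add: smooth_on_def Ck_on_const)

lemma smooth_on_linear: "bounded_linear f \<Longrightarrow> smooth_on S f"
  by (simp add: smooth_on_def Ck_on_linear)

lemma smooth_on_add:
  "open S \<Longrightarrow> smooth_on S f \<Longrightarrow> smooth_on S g \<Longrightarrow> smooth_on S (\<lambda>x. f x + g x)"
  by (simp add: smooth_on_def Ck_on_add)

lemma smooth_on_bilinear:
  "bounded_bilinear b \<Longrightarrow> open S \<Longrightarrow> smooth_on S f \<Longrightarrow> smooth_on S g \<Longrightarrow>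
    smooth_on S (\<lambda>x. b (f x) (g x))"
  by (simp add: smooth_on_def Ck_on_bilinear)

lemmas smooth_on_scaleR = smooth_on_bilinear[OF bounded_bilinear_scaleR]
lemmas smooth_on_inner = smooth_on_bilinear[OF bounded_bilinear_inner]

lemma smooth_on_minus:
  fixes f :: "'a::real_normed_vector \<Rightarrow> 'b::real_normed_vector"
  assumes "open S" "smooth_on S f"
  shows "smooth_on S (\<lambda>x. - f x)"
  using smooth_on_scaleR[OF assms(1) smooth_on_const[of S "-1"] assms(2)] by simp

lemma smooth_on_diff:
  fixes f g :: "'a::real_normed_vector \<Rightarrow> 'b::real_normed_vector"
  assumes "open S" "smooth_on S f" "smooth_on S g"
  shows "smooth_on S (\<lambda>x. f x - g x)"
  using smooth_on_add[OF assms(1,2) smooth_on_minus[OF assms(1,3)]] by simp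

lemma smooth_on_sum:
  assumes "open S" "finite I" "\<And>i. i \<in> I \<Longrightarrow> smooth_on S (f i)"
  shows "smooth_on S (\<lambda>x. \<Sum>i\<in>I. f i x)"
  using assms(2,3)
  by (induction I rule: finite_induct) (auto intro: smooth_on_const smooth_on_add[OF assms(1)])

text \<open>The map \<open>\<lambda>r y. r *\<^sub>R l y\<close> is bilinear, so composing with
  \<open>l\<close> is a product with the constant 1 and takes no induction of its own.\<close>

lemma smooth_on_comp_linear:
  assumes "bounded_linear l" "open S" "smooth_on S f"
  shows "smooth_on S (\<lambda>x. l (f x))"
proof -
  have "bounded_bilinear (\<lambda>(r::real) y. r *\<^sub>R l y)"
    using assms(1) bounded_bilinear.comp bounded_bilinear_scaleR bounded_linear_ident by blast
  from smooth_on_bilinear[OF this assms(2) smooth_on_const[of S 1] assms(3)]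
  show ?thesis by simp
qed

lemma smooth_on_Pair:
  assumes "open S" "smooth_on S f" "smooth_on S g"
  shows "smooth_on S (\<lambda>x. (f x, g x))"
proof -
  have "smooth_on S (\<lambda>x. (f x, 0) + (0, g x))"
    by (intro smooth_on_add assms(1) smooth_on_comp_linear[OF _ assms(1,2)]
        smooth_on_comp_linear[OF _ assms(1,3)] bounded_linear_Pair bounded_linear_ident bounded_linear_zero)
  then show ?thesis by simp
qed

lemma smooth_on_derivative: "smooth_on S f \<Longrightarrow> smooth_on S (\<lambda>x. frechet_derivative f (at x) v)"
  using Ck_on.simps(2) unfolding smooth_on_def by blast

lemma smooth_on_imp_differentiable: "smooth_on S f \<Longrightarrow> x \<in> S \<Longrightarrow> f differentiable (at x)"
  using Ck_on.simps(2) unfolding smooth_on_def by blast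

lemma smooth_on_imp_has_derivative:
  "smooth_on S f \<Longrightarrow> x \<in> S \<Longrightarrow> (f has_derivative frechet_derivative f (at x)) (at x)"
  using smooth_on_imp_differentiable frechet_derivative_works by blast

section \<open>Symmetry of second derivatives\<close>

text \<open>Two mean value arguments: the second difference over a parallelogram is an increment
  along \<open>u\<close> of increments along \<open>v\<close>, which makes it \<open>s * s\<close>
  times a mixed derivative at an intermediate point.\<close>

lemma second_difference:
  fixes f :: "'a::real_normed_vector \<Rightarrow> real"
  assumes f: "\<And>y. y \<in> ball x d \<Longrightarrow> (f has_derivative f' y) (at y)"
    and f': "\<And>y. y \<in> ball x d \<Longrightarrow> ((\<lambda>y. f' y u) has_derivative f'' y) (at y)"
    and s: "0 < s" "s * (norm u + norm v) < d"
  shows "\<exists>y\<in>ball x d. f (x + s *\<^sub>R u + s *\<^sub>R v) - f (x + s *\<^sub>R u) - f (x + s *\<^sub>R v) + f x = s * s * f'' y v"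
proof -
  have in_ball: "x + r *\<^sub>R u + r' *\<^sub>R v \<in> ball x d" if "0 \<le> r" "r \<le> s" "0 \<le> r'" "r' \<le> s" for r r'
  proof -
    have "norm (r *\<^sub>R u + r' *\<^sub>R v) \<le> r * norm u + r' * norm v"
      using norm_triangle_ineq[of "r *\<^sub>R u" "r' *\<^sub>R v"] that by simp
    also have "\<dots> \<le> s * norm u + s * norm v"
      using that by (intro add_mono mult_right_mono) auto
    finally have "norm (r *\<^sub>R u + r' *\<^sub>R v) < d"
      using s(2) by (simp add: distrib_left)
    moreover have "dist x (x + r *\<^sub>R u + r' *\<^sub>R v) = norm (r *\<^sub>R u + r' *\<^sub>R v)"
      by (metis add.assoc dist_add_cancel dist_0_norm add.right_neutral)
    ultimately show ?thesis by simp
  qed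
  have lin: "f' y (c *\<^sub>R w) = c * f' y w" "f'' y (c *\<^sub>R w) = c * f'' y w" if "y \<in> ball x d" for y c w
    using linear_simps(5)[OF has_derivative_bounded_linear[OF f[OF that]]]
      linear_simps(5)[OF has_derivative_bounded_linear[OF f'[OF that]]] by auto
  \<comment> \<open>The second difference is \<open>g s - g 0\<close>. The summand
    \<open>0 *\<^sub>R v\<close> gives both edges the shape covered by
    \<open>in_ball\<close>.\<close>
  define g where "g r = f (x + r *\<^sub>R u + s *\<^sub>R v) - f (x + r *\<^sub>R u + 0 *\<^sub>R v)" for r
  have "(g has_derivative (\<lambda>e. e * (f' (x + r *\<^sub>R u + s *\<^sub>R v) u - f' (x + r *\<^sub>R u + 0 *\<^sub>R v) u))) (at r within {0..s})"
    if r: "0 \<le> r" "r \<le> s" for r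
  proof -
    have "((\<lambda>r. f (x + r *\<^sub>R u + r' *\<^sub>R v)) has_derivative (\<lambda>e. f' (x + r *\<^sub>R u + r' *\<^sub>R v) (e *\<^sub>R u))) (at r within {0..s})"
      if "0 \<le> r'" "r' \<le> s" for r'
      by (rule has_derivative_compose[where g = f and f = "\<lambda>r. x + r *\<^sub>R u + r' *\<^sub>R v",
            OF _ f[OF in_ball[OF r that]]])
        (auto intro!: derivative_eq_intros)
    from has_derivative_diff[OF this[of s] this[of 0]]
    show ?thesis using s in_ball[OF r, of s] in_ball[OF r, of 0]
      unfolding g_def by (simp add: lin algebra_simps)
  qed
  from mvt_simple[OF s(1), of g "\<lambda>r e. e * (f' (x + r *\<^sub>R u + s *\<^sub>R v) u - f' (x + r *\<^sub>R u + 0 *\<^sub>R v) u)"] this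
  obtain r where r: "0 < r" "r < s"
    and gr: "g s - g 0 = s * (f' (x + r *\<^sub>R u + s *\<^sub>R v) u - f' (x + r *\<^sub>R u + 0 *\<^sub>R v) u)"
    by (auto simp: mult.commute)
  have "((\<lambda>r'. f' (x + r *\<^sub>R u + r' *\<^sub>R v) u) has_derivative (\<lambda>e. e * f'' (x + r *\<^sub>R u + r' *\<^sub>R v) v)) (at r' within {0..s})"
    if "0 \<le> r'" "r' \<le> s" for r'
  proof -
    have "((\<lambda>r'. f' (x + r *\<^sub>R u + r' *\<^sub>R v) u) has_derivative (\<lambda>e. f'' (x + r *\<^sub>R u + r' *\<^sub>R v) (e *\<^sub>R v))) (at r' within {0..s})"
      by (rule has_derivative_compose[where g = "\<lambda>y. f' y u" and f = "\<lambda>r'. x + r *\<^sub>R u + r' *\<^sub>R v",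
            OF _ f'[OF in_ball]])
        (use r that in \<open>auto intro!: derivative_eq_intros\<close>)
    then show ?thesis using in_ball[of r r'] r that by (simp add: lin)
  qed
  from mvt_simple[OF s(1), of "\<lambda>r'. f' (x + r *\<^sub>R u + r' *\<^sub>R v) u" "\<lambda>r' e. e * f'' (x + r *\<^sub>R u + r' *\<^sub>R v) v"] this
  obtain r' where r': "0 < r'" "r' < s"
    "f' (x + r *\<^sub>R u + s *\<^sub>R v) u - f' (x + r *\<^sub>R u + 0 *\<^sub>R v) u = s * f'' (x + r *\<^sub>R u + r' *\<^sub>R v) v"
    by (auto simp: mult.commute)
  show ?thesis
    using gr r' r in_ball[of r r']
    by (intro bexI[of _ "x + r *\<^sub>R u + r' *\<^sub>R v"]) (auto simp: g_def)
qed

text \<open>Schwarz's theorem. The second difference is unchanged when \<open>u\<close> and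
  \<open>v\<close> are swapped, so the two mixed derivatives take a common value at points
  arbitrarily close to \<open>x\<close>, and continuity gives equality at \<open>x\<close>. Inner
  products with a fixed \<open>w\<close> reduce to real values, where the mean value theorem
  applies.\<close>

lemma second_derivative_symmetric:
  fixes f :: "'a::real_normed_vector \<Rightarrow> 'b::real_inner"
  assumes "open S" "x \<in> S" "Ck_on 2 S f"
  shows "frechet_derivative (\<lambda>y. frechet_derivative f (at y) u) (at x) v =
    frechet_derivative (\<lambda>y. frechet_derivative f (at y) v) (at x) u" (is "?L = ?R")
proof -
  define f'' where "f'' u y v = frechet_derivative (\<lambda>y. frechet_derivative f (at y) u) (at y) v" for u v y
  have "w \<bullet> f'' u x v = w \<bullet> f'' v x u" for w
  proof (rule ccontr)
    assume neq: "w \<bullet> f'' u x v \<noteq> w \<bullet> f'' v x u"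
    \<comment> \<open>Half the gap: two numbers closer than \<open>e\<close> to the two distinct
      values cannot be equal.\<close>
    define e where "e = \<bar>w \<bullet> f'' u x v - w \<bullet> f'' v x u\<bar> / 2"
    have e: "e > 0" using neq by (simp add: e_def)
    have cont: "continuous_on S (\<lambda>y. w \<bullet> f'' u y v)" for u v
      using assms(3) unfolding f''_def by (auto simp: numeral_2_eq_2 intro: continuous_intros)
    then have "isCont (\<lambda>y. w \<bullet> f'' u y v) x" for u v
      using assms(1,2) continuous_on_eq_continuous_at by blast
    then have ev: "\<forall>\<^sub>F y in nhds x. \<bar>w \<bullet> f'' u y v - w \<bullet> f'' u x v\<bar> < e" for u v
      using e tendsto_at_iff_tendsto_nhds[of "\<lambda>y. w \<bullet> f'' u y v" x for u v]
      unfolding isCont_def tendsto_iff dist_real_def by auto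
    have "\<forall>\<^sub>F y in nhds x. y \<in> S \<and> \<bar>w \<bullet> f'' u y v - w \<bullet> f'' u x v\<bar> < e \<and> \<bar>w \<bullet> f'' v y u - w \<bullet> f'' v x u\<bar> < e"
      using eventually_nhds_in_open[OF assms(1,2)] ev[of u v] ev[of v u] by eventually_elim auto
    then obtain d where d: "d > 0"
      "\<And>y. y \<in> ball x d \<Longrightarrow> y \<in> S \<and> \<bar>w \<bullet> f'' u y v - w \<bullet> f'' u x v\<bar> < e \<and> \<bar>w \<bullet> f'' v y u - w \<bullet> f'' v x u\<bar> < e"
      unfolding eventually_nhds_metric by (auto simp: dist_commute)
    \<comment> \<open>Small enough to keep the parallelogram in the ball; the summand 1 covers the
      case that \<open>u\<close> and \<open>v\<close> both vanish.\<close>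
    define s where "s = d / (2 * (norm u + norm v + 1))"
    have n: "norm u + norm v + 1 > 0" by (smt (verit) norm_ge_zero)
    have s: "0 < s" "s * (norm u + norm v) < d"
      using d(1) n by (auto simp: s_def divide_simps)
    have D1: "((\<lambda>y. w \<bullet> f y) has_derivative (\<lambda>u. w \<bullet> frechet_derivative f (at y) u)) (at y)"
      if "y \<in> ball x d" for y
      using assms(3) d(2)[OF that]
      by (intro has_derivative_inner_right) (auto simp: numeral_2_eq_2 frechet_derivative_works)
    have D2: "((\<lambda>y. w \<bullet> frechet_derivative f (at y) u) has_derivative (\<lambda>v. w \<bullet> f'' u y v)) (at y)"
      if "y \<in> ball x d" for y u
      using assms(3) d(2)[OF that] unfolding f''_def
      by (intro has_derivative_inner_right) (auto simp: numeral_2_eq_2 frechet_derivative_works)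
    obtain y where y: "y \<in> ball x d"
      "w \<bullet> f (x + s *\<^sub>R u + s *\<^sub>R v) - w \<bullet> f (x + s *\<^sub>R u) - w \<bullet> f (x + s *\<^sub>R v) + w \<bullet> f x = s * s * (w \<bullet> f'' u y v)"
      using second_difference[where x = x and f = "\<lambda>y. w \<bullet> f y" and f'' = "\<lambda>y v. w \<bullet> f'' u y v", OF D1 D2 s]
      by auto
    have s': "s * (norm v + norm u) < d" using s(2) by (simp add: add.commute)
    obtain y' where y': "y' \<in> ball x d"
      "w \<bullet> f (x + s *\<^sub>R v + s *\<^sub>R u) - w \<bullet> f (x + s *\<^sub>R v) - w \<bullet> f (x + s *\<^sub>R u) + w \<bullet> f x = s * s * (w \<bullet> f'' v y' u)"
      using second_difference[where x = x and f = "\<lambda>y. w \<bullet> f y" and f'' = "\<lambda>y u. w \<bullet> f'' v y u", OF D1 D2 s(1) s']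
      by auto
    have comm: "x + s *\<^sub>R v + s *\<^sub>R u = x + s *\<^sub>R u + s *\<^sub>R v" by (simp add: algebra_simps)
    have "s * s * (w \<bullet> f'' u y v) = s * s * (w \<bullet> f'' v y' u)"
      using y(2) y'(2)[unfolded comm] by linarith
    then have "w \<bullet> f'' u y v = w \<bullet> f'' v y' u" using s(1) by simp
    then show False using d(2)[OF y(1)] d(2)[OF y'(1)] unfolding e_def by (auto simp: abs_if split: if_splits)
  qed
  then show ?thesis
    unfolding f''_def by (metis inner_commute vector_eq_ldot)
qed

section \<open>Orthonormal expansions\<close>

text \<open>Gram-Schmidt followed by normalisation. The set \<open>C\<close> serves as an
  orthonormal basis and may be empty, so dimension zero is covered.\<close>

lemma finite_span_orthonormal_expansion:
  fixes B :: "'e::real_inner set"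
  assumes "finite B" "span B = UNIV"
  obtains C :: "'e set" where "finite C" "\<And>u. u = (\<Sum>b\<in>C. (u \<bullet> b) *\<^sub>R b)"
proof -
  obtain D :: "'e set" where D: "finite D" "span D = UNIV" "pairwise orthogonal D"
    using basis_orthogonal[OF assms(1)] assms(2) by metis
  \<comment> \<open>An orthogonal spanning set may still contain 0, which cannot be
    normalised.\<close>
  define E where "E = D - {0}"
  have E: "finite E" "0 \<notin> E" "pairwise orthogonal E" "span E = UNIV"
    using D by (auto simp: E_def pairwise_def)
  define C where "C = (\<lambda>x. x /\<^sub>R norm x) ` E"
  \<comment> \<open>Reindexing the sum by the normalised vectors requires them to be distinct:
    nonzero parallel vectors are not orthogonal.\<close>
  have inj: "inj_on (\<lambda>x. x /\<^sub>R norm x) E"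
  proof (rule inj_onI, rule ccontr)
    fix x y assume xy: "x \<in> E" "y \<in> E" "x /\<^sub>R norm x = y /\<^sub>R norm y" "x \<noteq> y"
    then have "x \<bullet> y = 0" using E(3) by (auto simp: pairwise_def orthogonal_def)
    moreover have "y = (norm y / norm x) *\<^sub>R x"
      using xy E(2) by (metis divide_inverse norm_eq_zero scaleR_one scaleR_scaleR right_inverse)
    ultimately have "x \<bullet> x = 0 \<or> norm y = 0 \<or> norm x = 0"
      by (metis inner_scaleR_right mult_eq_0_iff divide_eq_0_iff)
    then show False using xy E(2) by auto
  qed
  have exp: "u = (\<Sum>x\<in>E. (u \<bullet> x / (x \<bullet> x)) *\<^sub>R x)" for u
  proof -
    \<comment> \<open>The remainder is orthogonal to \<open>E\<close>, hence to its span, which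
      contains the remainder itself.\<close>
    have "u - (\<Sum>x\<in>E. (u \<bullet> x / (x \<bullet> x)) *\<^sub>R x) = 0" (is "?d = 0")
    proof -
      have "orthogonal ?d y" if "y \<in> E" for y
      proof -
        have "(\<Sum>x\<in>E. (u \<bullet> x / (x \<bullet> x)) * (x \<bullet> y)) = (\<Sum>x\<in>E. if x = y then u \<bullet> y else 0)"
        proof (rule sum.cong[OF refl])
          show "(u \<bullet> x / (x \<bullet> x)) * (x \<bullet> y) = (if x = y then u \<bullet> y else 0)" if "x \<in> E" for x
            using E(2,3) that \<open>y \<in> E\<close> by (auto simp: pairwise_def orthogonal_def)
        qed
        also have "\<dots> = u \<bullet> y" using E(1) that by simp
        finally show ?thesis
          by (simp add: orthogonal_def inner_diff_left inner_sum_left)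
      qed
      then have "orthogonal ?d ?d"
        using orthogonal_to_span[of ?d E ?d] E(4) by auto
      then show ?thesis by (simp add: orthogonal_def)
    qed
    then show ?thesis by simp
  qed
  have "u = (\<Sum>b\<in>C. (u \<bullet> b) *\<^sub>R b)" for u
  proof -
    have "(\<Sum>b\<in>C. (u \<bullet> b) *\<^sub>R b) = (\<Sum>x\<in>E. (u \<bullet> (x /\<^sub>R norm x)) *\<^sub>R (x /\<^sub>R norm x))"
      unfolding C_def by (subst sum.reindex[OF inj]) (simp add: o_def)
    also have "\<dots> = (\<Sum>x\<in>E. (u \<bullet> x / (x \<bullet> x)) *\<^sub>R x)"
      by (intro sum.cong refl) (simp add: dot_square_norm power2_eq_square divide_simps)
    finally show ?thesis using exp by simp
  qed
  moreover have "finite C" using E(1) by (simp add: C_def)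
  ultimately show ?thesis using that by blast
qed


section \<open>Differentiable atlases\<close>

text \<open>A differentiable structure without a topology on the points; derivatives only see open
  overlaps in the model space. The cotangent and phase atlases thus become instances although no
  topology is put on them.\<close>

locale differentiable_atlas =
  fixes A :: "('m, 'e::real_normed_vector) chart set"
  assumes inj_on_chart: "c \<in> A \<Longrightarrow> inj_on (snd c) (fst c)"
    and open_overlap: "c \<in> A \<Longrightarrow> c' \<in> A \<Longrightarrow> open (snd c ` (fst c \<inter> fst c'))"
    and differentiable_transition:
      "c \<in> A \<Longrightarrow> c' \<in> A \<Longrightarrow> x \<in> fst c \<Longrightarrow> x \<in> fst c' \<Longrightarrow> (snd c' \<circ> chart_inv c) differentiable (at (snd c x))"
begin

lemma chart_inv_chart [simp]: "c \<in> A \<Longrightarrow> x \<in> fst c \<Longrightarrow> chart_inv c (snd c x) = x"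
  unfolding chart_inv_def by (rule inv_into_f_f[OF inj_on_chart])

lemma open_chart_image: "c \<in> A \<Longrightarrow> open (snd c ` fst c)"
  using open_overlap[of c c] by simp

lemma charts_atD: "c \<in> charts_at A x \<Longrightarrow> c \<in> A \<and> x \<in> fst c"
  by (simp add: charts_at_def)

lemma charts_atI: "c \<in> A \<Longrightarrow> x \<in> fst c \<Longrightarrow> c \<in> charts_at A x"
  by (simp add: charts_at_def)

lemma chart_at_in: "x \<in> points A \<Longrightarrow> chart_at A x \<in> charts_at A x"
  unfolding chart_at_def by (rule someI_ex) (auto simp: points_def charts_at_def)

lemma has_derivative_jacobian:
  assumes "c \<in> charts_at A x" "c' \<in> charts_at A x"
  shows "((snd c' \<circ> chart_inv c) has_derivative jacobian c c' x) (at (snd c x))"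
  unfolding jacobian_def
  using assms by (auto intro!: frechet_derivative_works[THEN iffD1] differentiable_transition dest: charts_atD)

lemma linear_jacobian:
  assumes "c \<in> charts_at A x" "c' \<in> charts_at A x"
  shows "linear (jacobian c c' x)"
  using has_derivative_linear[OF has_derivative_jacobian[OF assms]] .

text \<open>The chain rule. Reading \<open>f\<close> in \<open>c\<close> agrees with reading it in
  \<open>c'\<close> after the transition on the overlap, which is open.\<close>

lemma has_derivative_change_chart:
  assumes "c \<in> charts_at A x" "c' \<in> charts_at A x"
    and "((f \<circ> chart_inv c') has_derivative D) (at (snd c' x))"
  shows "((f \<circ> chart_inv c) has_derivative (\<lambda>v. D (jacobian c c' x v))) (at (snd c x))"
proof (rule has_derivative_transform_within_open)
  show "open (snd c ` (fst c \<inter> fst c'))" "snd c x \<in> snd c ` (fst c \<inter> fst c')"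
    using open_overlap assms charts_atD by auto
  have "snd c' x = (snd c' \<circ> chart_inv c) (snd c x)"
    using assms(1) by (auto dest: charts_atD)
  with diff_chain_at[OF has_derivative_jacobian[OF assms(1,2)], of "f \<circ> chart_inv c'" D] assms(3)
  show "((f \<circ> chart_inv c') \<circ> (snd c' \<circ> chart_inv c) has_derivative (\<lambda>v. D (jacobian c c' x v))) (at (snd c x))"
    by (simp add: o_def)
  show "((f \<circ> chart_inv c') \<circ> (snd c' \<circ> chart_inv c)) y = (f \<circ> chart_inv c) y"
    if "y \<in> snd c ` (fst c \<inter> fst c')" for y
    using that assms(1,2) by (auto dest!: charts_atD)
qed

text \<open>The cocycle rule is the change of chart for the function \<open>snd c''\<close>, by
  uniqueness of derivatives.\<close>

lemma jacobian_jacobian: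
  assumes "c \<in> charts_at A x" "c' \<in> charts_at A x" "c'' \<in> charts_at A x"
  shows "jacobian c' c'' x (jacobian c c' x u) = jacobian c c'' x u"
  using has_derivative_unique[OF has_derivative_change_chart[OF assms(1,2) has_derivative_jacobian[OF assms(2,3)]]
      has_derivative_jacobian[OF assms(1,3)]] by metis

lemma jacobian_self:
  assumes "c \<in> charts_at A x"
  shows "jacobian c c x u = u"
proof -
  have "((\<lambda>y. y) has_derivative jacobian c c x) (at (snd c x))"
    by (rule has_derivative_transform_within_open[OF has_derivative_jacobian[OF assms assms] open_chart_image[of c]])
      (use assms in \<open>auto dest!: charts_atD\<close>)
  from has_derivative_unique[OF this has_derivative_ident] show ?thesis by metis
qed

section \<open>Tangent vectors through their components in one chart\<close>

lemma coord_vec_in_tangent_space: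
  assumes "c \<in> charts_at A x"
  shows "coord_vec A c x u \<in> tangent_space A x"
  using jacobian_jacobian[OF assms] by (simp add: tangent_space_def coord_vec_def)

lemma coord_vec_apply: "c' \<in> charts_at A x \<Longrightarrow> coord_vec A c x u c' = jacobian c c' x u"
  by (simp add: coord_vec_def)

lemma coord_vec_same [simp]: "c \<in> charts_at A x \<Longrightarrow> coord_vec A c x u c = u"
  by (simp add: coord_vec_def jacobian_self)

lemma tangent_space_jacobian:
  "v \<in> tangent_space A x \<Longrightarrow> c \<in> charts_at A x \<Longrightarrow> c' \<in> charts_at A x \<Longrightarrow> v c' = jacobian c c' x (v c)"
  unfolding tangent_space_def by blast

lemma tangent_space_outside: "v \<in> tangent_space A x \<Longrightarrow> c \<notin> charts_at A x \<Longrightarrow> v c = 0"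
  unfolding tangent_space_def by blast

lemma tangent_spaceI:
  assumes "\<And>c c'. c \<in> charts_at A x \<Longrightarrow> c' \<in> charts_at A x \<Longrightarrow> v c' = jacobian c c' x (v c)"
    and "\<And>c. c \<notin> charts_at A x \<Longrightarrow> v c = 0"
  shows "v \<in> tangent_space A x"
  unfolding tangent_space_def using assms by blast

lemma coord_vec_component:
  assumes "v \<in> tangent_space A x" "c \<in> charts_at A x"
  shows "coord_vec A c x (v c) = v"
proof
  fix c'
  show "coord_vec A c x (v c) c' = v c'"
    using tangent_space_jacobian[OF assms, of c'] tangent_space_outside[OF assms(1), of c']
    by (simp add: coord_vec_def)
qed

lemma tangent_space_eqI:
  assumes "v \<in> tangent_space A x" "w \<in> tangent_space A x" "c \<in> charts_at A x" "v c = w c"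
  shows "v = w"
  using coord_vec_component assms by metis

lemma coord_vec_eq_iff:
  assumes "v \<in> tangent_space A x" "c \<in> charts_at A x"
  shows "v = coord_vec A c x u \<longleftrightarrow> v c = u"
  using coord_vec_component[OF assms] coord_vec_same[OF assms(2)] by metis

text \<open>Components in a chart identify the tangent space with the model space; this turns
  pointwise equations of forms into equations on the model space.\<close>

lemma ball_tangent_space:
  assumes "c \<in> charts_at A x"
  shows "(\<forall>w\<in>tangent_space A x. P (w c)) \<longleftrightarrow> (\<forall>u. P u)"
  using coord_vec_same[OF assms] coord_vec_in_tangent_space[OF assms] by metis

lemma tangent_space_add:
  assumes "v \<in> tangent_space A x" "w \<in> tangent_space A x"
  shows "(\<lambda>c. v c + w c) \<in> tangent_space A x"
proof (rule tangent_spaceI)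
  show "v c' + w c' = jacobian c c' x (v c + w c)" if "c \<in> charts_at A x" "c' \<in> charts_at A x" for c c'
    using tangent_space_jacobian[OF assms(1) that] tangent_space_jacobian[OF assms(2) that]
      linear_add[OF linear_jacobian[OF that]] by metis
  show "v c + w c = 0" if "c \<notin> charts_at A x" for c
    using assms[THEN tangent_space_outside, OF that] by simp
qed

lemma tangent_space_scaleR:
  assumes "v \<in> tangent_space A x"
  shows "(\<lambda>c. r *\<^sub>R v c) \<in> tangent_space A x"
proof (rule tangent_spaceI)
  show "r *\<^sub>R v c' = jacobian c c' x (r *\<^sub>R v c)" if "c \<in> charts_at A x" "c' \<in> charts_at A x" for c c'
    using tangent_space_jacobian[OF assms that] linear_scale[OF linear_jacobian[OF that]] by metis
  show "r *\<^sub>R v c = 0" if "c \<notin> charts_at A x" for c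
    using tangent_space_outside[OF assms that] by simp
qed

text \<open>Allows objects defined by means of \<open>chart_at\<close> to be evaluated in whichever
  chart is convenient.\<close>

lemma frechet_derivative_chart_independent:
  assumes "c \<in> charts_at A x" "c' \<in> charts_at A x" "v \<in> tangent_space A x"
    and "(f \<circ> chart_inv c') differentiable (at (snd c' x))"
  shows "frechet_derivative (f \<circ> chart_inv c) (at (snd c x)) (v c) =
    frechet_derivative (f \<circ> chart_inv c') (at (snd c' x)) (v c')"
proof -
  have "((f \<circ> chart_inv c) has_derivative
      (\<lambda>v. frechet_derivative (f \<circ> chart_inv c') (at (snd c' x)) (jacobian c c' x v))) (at (snd c x))"
    using has_derivative_change_chart[OF assms(1,2) assms(4)[unfolded frechet_derivative_works]] .
  from frechet_derivative_at[OF this] show ?thesis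
    using tangent_space_jacobian[OF assms(3,1,2)] by metis
qed

lemma differential_chart:
  assumes "c \<in> charts_at A x" "v \<in> tangent_space A x"
    and "\<And>c. c \<in> charts_at A x \<Longrightarrow> (f \<circ> chart_inv c) differentiable (at (snd c x))"
  shows "differential A f x v = frechet_derivative (f \<circ> chart_inv c) (at (snd c x)) (v c)"
proof -
  have "x \<in> points A" using assms(1) by (auto simp: charts_at_def points_def)
  from frechet_derivative_chart_independent[OF chart_at_in[OF this] assms(1,2) assms(3)[OF assms(1)]]
  show ?thesis by (simp add: differential_def Let_def)
qed

lemma smooth_fun_differentiable:
  assumes "smooth_fun A f" "c \<in> charts_at A x"
  shows "(f \<circ> chart_inv c) differentiable (at (snd c x))"
  using assms by (auto simp: smooth_fun_def dest!: charts_atD intro!: smooth_on_imp_differentiable)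

end

text \<open>Both charts are arbitrary: the source chart may be changed by chart independence, the
  target chart by composing with the transition from \<open>d\<close>. Since \<open>f\<close> maps
  the domain of \<open>c\<close> into that of \<open>d\<close>, \<open>chart_inv d\<close> undoes
  \<open>snd d\<close> on the whole chart image.\<close>

lemma (in differentiable_atlas) tangent_map_eq_coord_vec:
  assumes "differentiable_atlas A'" "c \<in> charts_at A x" "d \<in> charts_at A' (f x)"
    and "v \<in> tangent_space A x" "\<And>y. y \<in> fst c \<Longrightarrow> f y \<in> fst d"
    and "((snd d \<circ> f \<circ> chart_inv c) has_derivative D) (at (snd c x))"
  shows "tangent_map A A' f x v = coord_vec A' d (f x) (D (v c))"
proof
  interpret A': differentiable_atlas A' by fact
  have x: "x \<in> points A" using assms(2) by (auto simp: charts_at_def points_def)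
  fix d'
  show "tangent_map A A' f x v d' = coord_vec A' d (f x) (D (v c)) d'"
  proof (cases "d' \<in> charts_at A' (f x)")
    case True
    have inv: "chart_inv c (snd c x) = x" "chart_inv d (snd d (f x)) = f x"
      using assms(2,3) by (auto dest!: charts_atD A'.charts_atD)
    have 1: "((snd d' \<circ> chart_inv d \<circ> (snd d \<circ> f \<circ> chart_inv c)) has_derivative
        (\<lambda>u. jacobian d d' (f x) (D u))) (at (snd c x))"
      using diff_chain_at[OF assms(6), of "snd d' \<circ> chart_inv d" "jacobian d d' (f x)"]
        A'.has_derivative_jacobian[OF assms(3) True] inv by (simp add: o_def)
    have cA: "c \<in> A" "d \<in> A'" and sx: "snd c x \<in> snd c ` fst c"
      using assms(2,3) charts_atD A'.charts_atD by blast+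
    have 2: "(snd d' \<circ> chart_inv d \<circ> (snd d \<circ> f \<circ> chart_inv c)) y = (snd d' \<circ> f \<circ> chart_inv c) y"
      if "y \<in> snd c ` fst c" for y
    proof -
      from that obtain x' where x': "x' \<in> fst c" "y = snd c x'" by blast
      then show ?thesis using cA assms(5)[OF x'(1)] by simp
    qed
    have *: "((snd d' \<circ> f \<circ> chart_inv c) has_derivative (\<lambda>u. jacobian d d' (f x) (D u))) (at (snd c x))"
      by (rule has_derivative_transform_within_open[OF 1 open_chart_image[OF cA(1)] sx 2])
    have "tangent_map A A' f x v d' = frechet_derivative (snd d' \<circ> f \<circ> chart_inv c) (at (snd c x)) (v c)"
      using frechet_derivative_chart_independent[OF chart_at_in[OF x] assms(2,4) differentiableI[OF *]] True
      by (simp add: tangent_map_def Let_def)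
    also have "\<dots> = jacobian d d' (f x) (D (v c))"
      by (rule fun_cong[OF frechet_derivative_at[OF *, symmetric]])
    finally show ?thesis using True by (simp add: coord_vec_def)
  qed (simp add: tangent_map_def coord_vec_def Let_def)
qed

section \<open>Products with a vector space\<close>

text \<open>The passage from \<open>cotangent_atlas\<close> to \<open>phase_atlas\<close>, for a
  general extra factor; there the factor consists of the pairs of \<open>S\<close> and
  \<open>t\<close>.\<close>

definition times_chart :: "('m, 'e) chart \<Rightarrow> ('m \<times> 'b, 'e \<times> 'b) chart" where
  "times_chart c = (fst c \<times> UNIV, map_prod (snd c) id)"

lemma times_chart_simps [simp]:
  "fst (times_chart c) = fst c \<times> UNIV" "snd (times_chart c) (x, s) = (snd c x, s)"
  by (simp_all add: times_chart_def)

text \<open>Transitions act as those of \<open>A\<close> on the first factor and as the identity on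
  the second, so overlaps and derivatives split as products. Both conclusions rest on this one
  computation.\<close>

lemma (in differentiable_atlas)
  shows differentiable_atlas_times:
      "differentiable_atlas ((times_chart :: ('m, 'e) chart \<Rightarrow> ('m \<times> 'b::real_normed_vector, 'e \<times> 'b) chart) ` A)"
    and jacobian_times: "c \<in> charts_at A x \<Longrightarrow> c' \<in> charts_at A x \<Longrightarrow>
      jacobian (times_chart c) (times_chart c') (x, s :: 'b) u = (jacobian c c' x (fst u), snd u)"
proof -
  have inj: "inj_on (snd (times_chart c)) (fst (times_chart c) :: ('m \<times> 'b) set)" if "c \<in> A" for c
    using inj_on_chart[OF that] by (auto simp: inj_on_def)
  have overlap: "snd (times_chart c) ` (fst (times_chart c) \<inter> fst (times_chart c')) =
      (snd c ` (fst c \<inter> fst c')) \<times> (UNIV :: 'b set)" for c c'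
    by force
  have inv: "chart_inv (times_chart c) (snd c y, r) = (y, r)" if "c \<in> A" "y \<in> fst c" for c y and r :: 'b
    using inv_into_f_f[OF inj[OF that(1)], of "(y, r)"] that by (simp add: chart_inv_def)
  have D: "((snd (times_chart c') \<circ> chart_inv (times_chart c)) has_derivative (\<lambda>u. (jacobian c c' x (fst u), snd u))) (at (snd c x, s))"
    if "c \<in> charts_at A x" "c' \<in> charts_at A x" for c c' x and s :: 'b
  proof (rule has_derivative_transform_within_open)
    show "open ((snd c ` (fst c \<inter> fst c')) \<times> (UNIV :: 'b set))"
      "(snd c x, s) \<in> (snd c ` (fst c \<inter> fst c')) \<times> UNIV"
      using open_overlap[of c c'] charts_atD[OF that(1)] charts_atD[OF that(2)] by (simp_all add: open_Times)
    have "((\<lambda>y. (snd c' \<circ> chart_inv c) (fst y)) has_derivative (\<lambda>u. jacobian c c' x (fst u))) (at (snd c x, s))"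
      by (rule has_derivative_compose[OF has_derivative_fst[OF has_derivative_ident]])
        (use has_derivative_jacobian[OF that] in \<open>simp add: o_def\<close>)
    then show "((\<lambda>y. ((snd c' \<circ> chart_inv c) (fst y), snd y)) has_derivative (\<lambda>u. (jacobian c c' x (fst u), snd u)))
        (at (snd c x, s))"
      by (intro has_derivative_Pair has_derivative_snd[OF has_derivative_ident])
    show "((snd c' \<circ> chart_inv c) (fst y), snd y) = (snd (times_chart c') \<circ> chart_inv (times_chart c)) y"
      if "y \<in> (snd c ` (fst c \<inter> fst c')) \<times> (UNIV :: 'b set)" for y
      using that \<open>c \<in> charts_at A x\<close> by (auto simp: inv dest!: charts_atD)
  qed
  show "jacobian (times_chart c) (times_chart c') (x, s) u = (jacobian c c' x (fst u), snd u)"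
    if "c \<in> charts_at A x" "c' \<in> charts_at A x"
    using frechet_derivative_at[OF D[OF that, of s]] unfolding jacobian_def by (simp add: fun_eq_iff)
  show "differentiable_atlas ((times_chart :: ('m, 'e) chart \<Rightarrow> ('m \<times> 'b, 'e \<times> 'b) chart) ` A)"
  proof (unfold_locales; elim imageE; hypsubst)
    show "inj_on (snd (times_chart c)) (fst (times_chart c) :: ('m \<times> 'b) set)" if "c \<in> A" for c by (rule inj[OF that])
    show "open (snd (times_chart c) ` (fst (times_chart c) \<inter> fst (times_chart c')) :: ('e \<times> 'b) set)" if "c \<in> A" "c' \<in> A" for c c'
      unfolding overlap using open_overlap[OF that] by (simp add: open_Times)
    show "(snd (times_chart c') \<circ> chart_inv (times_chart c)) differentiable at (snd (times_chart c) z)"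
      if "z \<in> fst (times_chart c)" "z \<in> fst (times_chart c')" "c \<in> A" "c' \<in> A" for c c' and z :: "'m \<times> 'b"
      using differentiableI[OF D[of c "fst z" c' "snd z"]] that by (cases z) (auto simp: charts_at_def)
  qed
qed


section \<open>Contact geometry in coordinates\<close>

text \<open>
  With \<open>y = ((q, p), (S, t))\<close>, these are \<open>dS - p dq\<close>, \<open>dS - p dq + h dt\<close> and \<open>dq \<and> dp\<close>.
\<close>

definition contact_coord :: "'e::real_inner phase_model \<Rightarrow> 'e phase_model \<Rightarrow> real" where
  "contact_coord y u = fst (snd u) - snd (fst y) \<bullet> fst (fst u)"

definition ext_contact_coord ::
  "('e::real_inner phase_model \<Rightarrow> real) \<Rightarrow> 'e phase_model \<Rightarrow> 'e phase_model \<Rightarrow> real" where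
  "ext_contact_coord h y u = contact_coord y u + h y * snd (snd u)"

definition symplectic_coord :: "'e::real_inner phase_model \<Rightarrow> 'e phase_model \<Rightarrow> real" where
  "symplectic_coord v w = snd (fst w) \<bullet> fst (fst v) - snd (fst v) \<bullet> fst (fst w)"

text \<open>The vector representing a linear functional when \<open>B\<close> is an orthonormal
  basis; it serves to write gradients.\<close>

definition riesz :: "'e::real_inner set \<Rightarrow> ('e \<Rightarrow> real) \<Rightarrow> 'e" where
  "riesz B l = (\<Sum>b\<in>B. l b *\<^sub>R b)"

text \<open>The classical coordinate expression of \<open>X_F\<close>, with the gradients in q and p
  supplied by \<open>riesz\<close>.\<close>

definition ham_coord ::
  "'e::real_inner set \<Rightarrow> ('e phase_model \<Rightarrow> real) \<Rightarrow> 'e phase_model \<Rightarrow> 'e phase_model" where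
  "ham_coord B F y =
     (let D = frechet_derivative F (at y);
          a = riesz B (\<lambda>b. D ((0, b), (0, 0)))
      in ((a, - riesz B (\<lambda>b. D ((b, 0), (0, 0))) - D ((0, 0), (1, 0)) *\<^sub>R snd (fst y)),
          (snd (fst y) \<bullet> a - F y, 0)))"

lemma has_derivative_contact_coord:
  "((\<lambda>y. contact_coord y u) has_derivative (\<lambda>v. - (snd (fst v) \<bullet> fst (fst u)))) (at y)"
  unfolding contact_coord_def by (auto intro!: derivative_eq_intros)

text \<open>An orthonormal basis in the form in which it is used, for a model space that may have
  dimension zero.\<close>

locale orthonormal_expansion =
  fixes B :: "'e::real_inner set"
  assumes finite_basis: "finite B"
    and expansion: "\<And>u::'e. u = (\<Sum>b\<in>B. (u \<bullet> b) *\<^sub>R b)"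
begin

lemma riesz_inner:
  assumes "linear l"
  shows "riesz B l \<bullet> u = l u"
proof -
  have "l u = l (\<Sum>b\<in>B. (u \<bullet> b) *\<^sub>R b)" using expansion[of u] by simp
  also have "\<dots> = (\<Sum>b\<in>B. (u \<bullet> b) * l b)" using assms by (simp add: linear_sum linear_scale)
  finally show ?thesis unfolding riesz_def inner_sum_left by (simp add: inner_commute mult.commute)
qed

text \<open>Names the partial derivatives of a function of \<open>((q, p), (S, t))\<close>, so that
  the later identities become algebra of gradients.\<close>

lemma linear_phase_expansion:
  fixes D :: "'e phase_model \<Rightarrow> real"
  assumes "linear D"
  shows "D w = riesz B (\<lambda>b. D ((b, 0), (0, 0))) \<bullet> fst (fst w) + riesz B (\<lambda>b. D ((0, b), (0, 0))) \<bullet> snd (fst w)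
    + D ((0, 0), (1, 0)) * fst (snd w) + D ((0, 0), (0, 1)) * snd (snd w)"
proof -
  interpret linear D by fact
  have 1: "linear (\<lambda>b. D ((b, 0), (0, 0)))" "linear (\<lambda>b. D ((0, b), (0, 0)))"
    using add[of "((_, 0), (0, 0))" "((_, 0), (0, 0))"] scale[of _ "((_, 0), (0, 0))"]
      add[of "((0, _), (0, 0))" "((0, _), (0, 0))"] scale[of _ "((0, _), (0, 0))"]
    by (auto intro!: linearI)
  obtain a b s t where w: "w = ((a, b), (s, t))" by (metis prod.collapse)
  have "D w = D (((a, 0), (0, 0)) + ((0, b), (0, 0)) + s *\<^sub>R ((0, 0), (1, 0)) + t *\<^sub>R ((0, 0), (0, 1)))"
    by (simp add: w)
  also have "\<dots> = D ((a, 0), (0, 0)) + D ((0, b), (0, 0)) + D ((0, 0), (1, 0)) * s + D ((0, 0), (0, 1)) * t"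
    unfolding add scale by simp
  finally show ?thesis by (simp add: w riesz_inner[OF 1(1)] riesz_inner[OF 1(2)])
qed

text \<open>The right-hand side is the defining system of \<open>X_F\<close>. Momentum directions
  determine the q component, position directions the p component and the contraction the S
  component, so the definite description has exactly one solution.\<close>

lemma ham_coord_unique:
  fixes F :: "'e phase_model \<Rightarrow> real"
  assumes "(F has_derivative D) (at y)"
  shows "v = ham_coord B F y \<longleftrightarrow>
    snd (snd v) = 0 \<and> contact_coord y v = - F y \<and>
    (\<forall>w. snd (snd w) = 0 \<longrightarrow>
       symplectic_coord v w = D w - D ((0, 0), (1, 0)) * contact_coord y w)"
proof -
  have D: "frechet_derivative F (at y) = D" using frechet_derivative_at[OF assms] by simp
  define Fq Fp FS Ft where "Fq = riesz B (\<lambda>b. D ((b, 0), (0, 0)))" "Fp = riesz B (\<lambda>b. D ((0, b), (0, 0)))"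
    "FS = D ((0, 0), (1, 0))" "Ft = D ((0, 0), (0, 1))"
  note coeffs_def = this
  note exp = linear_phase_expansion[OF has_derivative_linear[OF assms], folded coeffs_def]
  obtain a b s t where v: "v = ((a, b), (s, t))" by (metis prod.collapse)
  define p where "p = snd (fst y)"
  have ham: "ham_coord B F y = ((Fp, - Fq - FS *\<^sub>R p), (p \<bullet> Fp - F y, 0))"
    unfolding ham_coord_def Let_def D coeffs_def p_def by simp
  show ?thesis (is "?l \<longleftrightarrow> ?r")
  proof
    assume ?l
    then show ?r
      unfolding ham symplectic_coord_def contact_coord_def p_def[symmetric] coeffs_def(3)[symmetric]
      by (simp add: exp algebra_simps inner_simps inner_commute)
  next
    assume r: ?r
    have t: "t = 0" using r v by simp
    have "\<forall>w. w \<bullet> a = w \<bullet> Fp"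
    proof
      fix w
      show "w \<bullet> a = w \<bullet> Fp"
        using r[THEN conjunct2, THEN conjunct2, rule_format, of "((0, w), (0, 0))"] v
        unfolding exp[of "((0, w), (0, 0))"] by (simp add: symplectic_coord_def contact_coord_def inner_commute)
    qed
    then have a: "a = Fp" by (simp add: vector_eq_ldot)
    \<comment> \<open>On a position direction the contact form is \<open>- (p \<bullet> w)\<close>,
      which produces the dissipative term \<open>FS *\<^sub>R p\<close>.\<close>
    have "\<forall>w. w \<bullet> b = w \<bullet> (- Fq - FS *\<^sub>R p)"
    proof
      fix w
      show "w \<bullet> b = w \<bullet> (- Fq - FS *\<^sub>R p)"
        using r[THEN conjunct2, THEN conjunct2, rule_format, of "((w, 0), (0, 0))"] v
        unfolding exp[of "((w, 0), (0, 0))"]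
        by (simp add: symplectic_coord_def contact_coord_def inner_simps inner_commute p_def coeffs_def(3))
    qed
    then have b: "b = - Fq - FS *\<^sub>R p" by (simp add: vector_eq_ldot)
    have s: "s = p \<bullet> a - F y" using r v by (simp add: contact_coord_def p_def)
    show ?l
      unfolding v t b s a ham by simp
  qed
qed

section \<open>The Noether equation in coordinates\<close>

text \<open>Cartan's formula, with the contraction equal to \<open>- F\<close>. That condition holds
  on a neighbourhood, and differentiating it eliminates the derivative of \<open>V\<close>; what
  remains is the contraction of the exterior derivative minus the differential of
  \<open>F\<close>.\<close>

lemma lie_ext_contact_coord:
  fixes h F :: "'e phase_model \<Rightarrow> real" and V :: "'e phase_model \<Rightarrow> 'e phase_model"
  assumes U: "open U" "y \<in> U"
    and V: "V differentiable (at y)"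
    and h: "(h has_derivative Dh) (at y)" and F: "(F has_derivative DF) (at y)"
    and contr: "\<And>y. y \<in> U \<Longrightarrow> - ext_contact_coord h y (V y) = F y"
  shows "frechet_derivative (\<lambda>y. ext_contact_coord h y w) (at y) (V y)
      + ext_contact_coord h y (frechet_derivative V (at y) w) =
    symplectic_coord (V y) w + Dh (V y) * snd (snd w) - snd (snd (V y)) * Dh w - DF w"
proof -
  define DV where "DV = frechet_derivative V (at y)"
  have DV: "(V has_derivative DV) (at y)" using V unfolding DV_def frechet_derivative_works .
  have "((\<lambda>y. ext_contact_coord h y w) has_derivative
      (\<lambda>v. - (snd (fst v) \<bullet> fst (fst w)) + Dh v * snd (snd w))) (at y)"
    unfolding ext_contact_coord_def by (intro derivative_intros has_derivative_contact_coord h)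
  note 1 = frechet_derivative_at[OF this, symmetric]
  have "((\<lambda>y. - ext_contact_coord h y (V y)) has_derivative
      (\<lambda>w. - (fst (snd (DV w)) - (snd (fst y) \<bullet> fst (fst (DV w)) + snd (fst w) \<bullet> fst (fst (V y)))
        + (h y * snd (snd (DV w)) + Dh w * snd (snd (V y)))))) (at y)"
    unfolding ext_contact_coord_def contact_coord_def
    by (intro derivative_intros DV h)
  then have "((\<lambda>y. - ext_contact_coord h y (V y)) has_derivative
      (\<lambda>w. - (- (snd (fst w) \<bullet> fst (fst (V y))) + Dh w * snd (snd (V y)) + ext_contact_coord h y (DV w)))) (at y)"
    by (rule has_derivative_eq_rhs) (simp add: ext_contact_coord_def contact_coord_def fun_eq_iff)
  from has_derivative_transform_within_open[OF this U contr]
  have "DF w = - (- (snd (fst w) \<bullet> fst (fst (V y))) + Dh w * snd (snd (V y)) + ext_contact_coord h y (DV w))"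
    by (rule fun_cong[OF has_derivative_unique[OF F]])
  then show ?thesis unfolding 1 DV_def[symmetric] symplectic_coord_def by (simp add: algebra_simps)
qed

text \<open>The equations force the multiplier and all components of \<open>v\<close> except the one
  along t; that component stays free and becomes the coefficient of \<open>X_h^t\<close>.\<close>

lemma noether_coord_necessary:
  fixes h F :: "'e phase_model \<Rightarrow> real"
  assumes h: "(h has_derivative Dh) (at y)" and F: "(F has_derivative DF) (at y)"
    and sym: "\<And>w. symplectic_coord v w + Dh v * snd (snd w) - snd (snd v) * Dh w - DF w = l * ext_contact_coord h y w"
    and contr: "ext_contact_coord h y v = - F y"
  shows "v = ham_coord B F y + snd (snd v) *\<^sub>R (ham_coord B h y + ((0, 0), (0, 1)))"
proof -
  have Dh: "frechet_derivative h (at y) = Dh" using frechet_derivative_at[OF h] by simp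
  have DF: "frechet_derivative F (at y) = DF" using frechet_derivative_at[OF F] by simp
  define hq hp hS ht where "hq = riesz B (\<lambda>b. Dh ((b, 0), (0, 0)))" "hp = riesz B (\<lambda>b. Dh ((0, b), (0, 0)))"
    "hS = Dh ((0, 0), (1, 0))" "ht = Dh ((0, 0), (0, 1))"
  note h_exp = linear_phase_expansion[OF has_derivative_linear[OF h], folded this]
  define Fq Fp FS Ft where "Fq = riesz B (\<lambda>b. DF ((b, 0), (0, 0)))" "Fp = riesz B (\<lambda>b. DF ((0, b), (0, 0)))"
    "FS = DF ((0, 0), (1, 0))" "Ft = DF ((0, 0), (0, 1))"
  note F_exp = linear_phase_expansion[OF has_derivative_linear[OF F], folded this]
  obtain a b s t where v: "v = ((a, b), (s, t))" by (metis prod.collapse)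
  define p where "p = snd (fst y)"
  \<comment> \<open>The form takes the value 1 on the Reeb direction, which therefore isolates the
    multiplier.\<close>
  have l: "l = - (t * hS + FS)"
    using sym[of "((0, 0), (1, 0))"] v
    by (simp add: symplectic_coord_def ext_contact_coord_def contact_coord_def hq_hp_hS_ht_def(3) Fq_Fp_FS_Ft_def(3))
  \<comment> \<open>Momentum directions are annihilated by the form, so the multiplier drops
    out.\<close>
  have "\<forall>w. w \<bullet> a = w \<bullet> (Fp + t *\<^sub>R hp)"
  proof
    fix w
    show "w \<bullet> a = w \<bullet> (Fp + t *\<^sub>R hp)"
      using sym[of "((0, w), (0, 0))"] v
      unfolding h_exp[of "((0, w), (0, 0))"] F_exp[of "((0, w), (0, 0))"]
      by (simp add: symplectic_coord_def ext_contact_coord_def contact_coord_def inner_simps inner_commute)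
  qed
  then have a: "a = Fp + t *\<^sub>R hp" by (simp add: vector_eq_ldot)
  have "\<forall>w. w \<bullet> b = w \<bullet> (l *\<^sub>R p - Fq - t *\<^sub>R hq)"
  proof
    fix w
    show "w \<bullet> b = w \<bullet> (l *\<^sub>R p - Fq - t *\<^sub>R hq)"
      using sym[of "((w, 0), (0, 0))"] v
      unfolding h_exp[of "((w, 0), (0, 0))"] F_exp[of "((w, 0), (0, 0))"]
      by (simp add: symplectic_coord_def ext_contact_coord_def contact_coord_def inner_simps inner_commute p_def)
  qed
  then have b: "b = l *\<^sub>R p - Fq - t *\<^sub>R hq" by (simp add: vector_eq_ldot)
  have s: "s = p \<bullet> a - h y * t - F y"
    using contr v by (simp add: ext_contact_coord_def contact_coord_def p_def)
  have ham: "ham_coord B F y = ((Fp, - Fq - FS *\<^sub>R p), (p \<bullet> Fp - F y, 0))"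
    "ham_coord B h y = ((hp, - hq - hS *\<^sub>R p), (p \<bullet> hp - h y, 0))"
    unfolding ham_coord_def Let_def Dh DF hq_hp_hS_ht_def Fq_Fp_FS_Ft_def p_def by simp_all
  show ?thesis unfolding ham v s b l a by (simp add: algebra_simps inner_simps)
qed

text \<open>The multiplier is the one forced by the Reeb direction. Substituting the components of
  \<open>v\<close> settles the q, p and S directions identically; the t direction is where
  \<open>diss\<close> enters.\<close>

lemma noether_coord_sufficient:
  fixes h F :: "'e phase_model \<Rightarrow> real"
  assumes h: "(h has_derivative Dh) (at y)" and F: "(F has_derivative DF) (at y)"
    and diss: "DF (ham_coord B h y + ((0, 0), (0, 1))) = - Dh ((0, 0), (1, 0)) * F y"
    and v: "v = ham_coord B F y + t *\<^sub>R (ham_coord B h y + ((0, 0), (0, 1)))"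
  shows "symplectic_coord v w + Dh v * snd (snd w) - snd (snd v) * Dh w - DF w =
      - (t * Dh ((0, 0), (1, 0)) + DF ((0, 0), (1, 0))) * ext_contact_coord h y w"
    and "ext_contact_coord h y v = - F y"
proof -
  have Dh: "frechet_derivative h (at y) = Dh" using frechet_derivative_at[OF h] by simp
  have DF: "frechet_derivative F (at y) = DF" using frechet_derivative_at[OF F] by simp
  define hq hp hS ht where "hq = riesz B (\<lambda>b. Dh ((b, 0), (0, 0)))" "hp = riesz B (\<lambda>b. Dh ((0, b), (0, 0)))"
    "hS = Dh ((0, 0), (1, 0))" "ht = Dh ((0, 0), (0, 1))"
  note h_def = this
  note h_exp = linear_phase_expansion[OF has_derivative_linear[OF h], folded h_def]
  define Fq Fp FS Ft where "Fq = riesz B (\<lambda>b. DF ((b, 0), (0, 0)))" "Fp = riesz B (\<lambda>b. DF ((0, b), (0, 0)))"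
    "FS = DF ((0, 0), (1, 0))" "Ft = DF ((0, 0), (0, 1))"
  note F_def = this
  note F_exp = linear_phase_expansion[OF has_derivative_linear[OF F], folded F_def]
  define p where "p = snd (fst y)"
  have ham: "ham_coord B F y = ((Fp, - Fq - FS *\<^sub>R p), (p \<bullet> Fp - F y, 0))"
    "ham_coord B h y = ((hp, - hq - hS *\<^sub>R p), (p \<bullet> hp - h y, 0))"
    unfolding ham_coord_def Let_def Dh DF h_def F_def p_def by simp_all
  have v': "v = ((Fp + t *\<^sub>R hp, - Fq - FS *\<^sub>R p - t *\<^sub>R (hq + hS *\<^sub>R p)),
      (p \<bullet> Fp - F y + t * (p \<bullet> hp - h y), t))"
    unfolding v ham by (simp add: algebra_simps)
  have diss': "Fq \<bullet> hp - (hq + hS *\<^sub>R p) \<bullet> Fp + (p \<bullet> hp - h y) * FS + Ft = - hS * F y"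
    using diss unfolding ham h_def(3)[symmetric] unfolding F_exp[where w = "((_, _), (_, _)) + _"]
    by (simp add: algebra_simps inner_simps inner_commute)
  \<comment> \<open>The Poisson bracket terms of \<open>h\<close> and \<open>F\<close> occur in
    \<open>diss'\<close> with the opposite sign and can be traded for derivatives of
    \<open>F\<close> along S and t. The terms with the factor \<open>t\<close> reduce to
    \<open>ht - hS * h y\<close>, the rate of change of \<open>h\<close> along its own
    evolution.\<close>
  have Dhv: "Dh v = Ft - FS * h y + t * (ht - hS * h y)"
    unfolding h_exp[of v] unfolding v' using diss'
    by (simp add: algebra_simps inner_simps inner_commute)
  obtain wq wp wS wt where w: "w = ((wq, wp), (wS, wt))" by (metis prod.collapse)
  show "symplectic_coord v w + Dh v * snd (snd w) - snd (snd v) * Dh w - DF w =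
      - (t * Dh ((0, 0), (1, 0)) + DF ((0, 0), (1, 0))) * ext_contact_coord h y w"
    unfolding Dhv unfolding h_exp[of w] F_exp[of w] h_def(3)[symmetric] F_def(3)[symmetric]
    unfolding v' w symplectic_coord_def ext_contact_coord_def contact_coord_def p_def[symmetric]
    by (simp add: algebra_simps inner_simps inner_commute)
  show "ext_contact_coord h y v = - F y"
    unfolding v' ext_contact_coord_def contact_coord_def p_def[symmetric]
    by (simp add: algebra_simps inner_simps)
qed

lemma smooth_on_ham_coord:
  fixes F :: "'e phase_model \<Rightarrow> real"
  assumes "open U" "smooth_on U F"
  shows "smooth_on U (ham_coord B F)"
proof -
  have p: "smooth_on U (\<lambda>y::'e phase_model. snd (fst y))"
    by (intro smooth_on_linear bounded_linear_compose[OF bounded_linear_snd bounded_linear_fst])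
  have r: "smooth_on U (\<lambda>y. riesz B (\<lambda>b. frechet_derivative F (at y) (g b)))" for g
    unfolding riesz_def
    by (intro smooth_on_sum smooth_on_scaleR smooth_on_derivative smooth_on_const assms finite_basis)
  have "smooth_on U (\<lambda>y. ham_coord B F y)"
    unfolding ham_coord_def Let_def
    by (intro smooth_on_Pair smooth_on_diff smooth_on_minus smooth_on_inner smooth_on_scaleR
        smooth_on_derivative smooth_on_const assms p r)
  then show ?thesis by (simp add: eta_contract_eq)
qed

end


section \<open>The phase space of a manifold\<close>

definition phase_chart :: "('q, 'e::real_inner) chart set \<Rightarrow> ('q, 'e) chart \<Rightarrow> (('q, 'e) phase, 'e phase_model) chart" where
  "phase_chart A c = times_chart (cotangent_chart A c)"

text \<open>Momentum transitions contain the Jacobian of a base transition, so differentiable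
  cotangent charts take one more derivative on the base than \<open>differentiable_atlas\<close>
  offers; smooth transitions provide it.\<close>

locale manifold_atlas = differentiable_atlas A + orthonormal_expansion B
  for A :: "('q, 'e::real_inner) chart set" and B :: "'e set" +
  assumes smooth_transition:
    "c \<in> A \<Longrightarrow> c' \<in> A \<Longrightarrow> smooth_on (snd c ` (fst c \<inter> fst c')) (snd c' \<circ> chart_inv c)"
begin

section \<open>Covectors in charts\<close>

text \<open>Resolves the definite description: \<open>riesz\<close> yields a representing vector,
  and inner products with all vectors determine it.\<close>

lemma covec_comp_inner:
  assumes "c \<in> charts_at A q" "\<xi> \<in> cotangent_space A q"
  shows "covec_comp A c q \<xi> \<bullet> u = \<xi> (coord_vec A c q u)"
proof -
  have "linear (\<lambda>u. \<xi> (coord_vec A c q u))"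
  proof (rule linearI)
    have in_ts: "coord_vec A c q u \<in> tangent_space A q" for u
      using coord_vec_in_tangent_space[OF assms(1)] .
    show "\<xi> (coord_vec A c q (u + v)) = \<xi> (coord_vec A c q u) + \<xi> (coord_vec A c q v)" for u v
    proof -
      have "coord_vec A c q (u + v) = (\<lambda>d. coord_vec A c q u d + coord_vec A c q v d)"
        using linear_add[OF linear_jacobian[OF assms(1)]] by (auto simp: coord_vec_def)
      then show ?thesis using assms(2) in_ts by (simp add: cotangent_space_def)
    qed
    show "\<xi> (coord_vec A c q (r *\<^sub>R u)) = r *\<^sub>R \<xi> (coord_vec A c q u)" for r u
    proof -
      have "coord_vec A c q (r *\<^sub>R u) = (\<lambda>d. r *\<^sub>R coord_vec A c q u d)"
        using linear_scale[OF linear_jacobian[OF assms(1)]] by (auto simp: coord_vec_def)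
      then show ?thesis using assms(2) in_ts by (simp add: cotangent_space_def)
    qed
  qed
  from riesz_inner[OF this]
  have ex: "\<forall>u. \<xi> (coord_vec A c q u) = riesz B (\<lambda>u. \<xi> (coord_vec A c q u)) \<bullet> u" by simp
  have "\<forall>u. \<xi> (coord_vec A c q u) = covec_comp A c q \<xi> \<bullet> u"
    unfolding covec_comp_def
  proof (rule theI)
    show "\<forall>u. \<xi> (coord_vec A c q u) = riesz B (\<lambda>u. \<xi> (coord_vec A c q u)) \<bullet> u" by (rule ex)
    show "p = riesz B (\<lambda>u. \<xi> (coord_vec A c q u))" if "\<forall>u. \<xi> (coord_vec A c q u) = p \<bullet> u" for p
      using that ex by (metis vector_eq_rdot)
  qed
  then show ?thesis by simp
qed

text \<open>Both sides evaluate the covector on the same tangent vector, written in two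
  charts.\<close>

lemma covec_comp_jacobian:
  assumes "c \<in> charts_at A q" "c' \<in> charts_at A q" "\<xi> \<in> cotangent_space A q"
  shows "covec_comp A c' q \<xi> \<bullet> jacobian c c' q u = covec_comp A c q \<xi> \<bullet> u"
proof -
  have "coord_vec A c' q (jacobian c c' q u) = coord_vec A c q u"
    using coord_vec_component[OF coord_vec_in_tangent_space[OF assms(1)] assms(2)] coord_vec_apply[OF assms(2)]
    by metis
  then show ?thesis using covec_comp_inner assms by simp
qed

text \<open>Makes the momentum transition explicit; it runs through the Jacobian in the opposite
  direction, from \<open>c'\<close> to \<open>c\<close>.\<close>

lemma covec_comp_transition:
  assumes "c \<in> charts_at A q" "c' \<in> charts_at A q" "\<xi> \<in> cotangent_space A q"
  shows "covec_comp A c' q \<xi> = riesz B (\<lambda>b. covec_comp A c q \<xi> \<bullet> jacobian c' c q b)"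
proof -
  have "covec_comp A c' q \<xi> = (\<Sum>b\<in>B. (covec_comp A c' q \<xi> \<bullet> b) *\<^sub>R b)"
    by (rule expansion)
  then show ?thesis using covec_comp_jacobian[OF assms(2,1,3)] by (simp add: riesz_def)
qed

lemma inj_on_covec_comp:
  assumes "c \<in> charts_at A q"
  shows "inj_on (covec_comp A c q) (cotangent_space A q)"
proof (rule inj_onI, rule ext)
  fix \<xi> \<xi>' v
  assume *: "\<xi> \<in> cotangent_space A q" "\<xi>' \<in> cotangent_space A q" "covec_comp A c q \<xi> = covec_comp A c q \<xi>'"
  show "\<xi> v = \<xi>' v"
  proof (cases "v \<in> tangent_space A q")
    case True
    then show ?thesis
      using covec_comp_inner[OF assms] * coord_vec_component[OF True assms] by metis
  next
    case False
    then show ?thesis using * by (simp add: cotangent_space_def)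
  qed
qed

lemma surj_covec_comp:
  assumes "c \<in> charts_at A q"
  shows "covec_comp A c q ` cotangent_space A q = UNIV"
proof -
  have "\<exists>\<xi>\<in>cotangent_space A q. covec_comp A c q \<xi> = p" for p
  proof
    \<comment> \<open>The pairing with \<open>p\<close> in the chart \<open>c\<close>, with the
      value 0 that \<open>cotangent_space\<close> prescribes off the tangent space.\<close>
    let ?\<xi> = "\<lambda>v. if v \<in> tangent_space A q then p \<bullet> v c else 0"
    show \<xi>: "?\<xi> \<in> cotangent_space A q"
      unfolding cotangent_space_def using tangent_space_add tangent_space_scaleR by (simp add: inner_add_right)
    have "covec_comp A c q ?\<xi> \<bullet> u = p \<bullet> u" for u
      using coord_vec_in_tangent_space[OF assms] coord_vec_same[OF assms]
      by (simp add: covec_comp_inner[OF assms \<xi>])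
    then show "covec_comp A c q ?\<xi> = p" using vector_eq_rdot by blast
  qed
  then show ?thesis by (metis UNIV_eq_I imageI)
qed

section \<open>Cotangent charts and phase charts\<close>

lemma cotangent_chart_simps [simp]:
  "(q, \<xi>) \<in> fst (cotangent_chart A c) \<longleftrightarrow> q \<in> fst c \<and> \<xi> \<in> cotangent_space A q"
  "snd (cotangent_chart A c) (q, \<xi>) = (snd c q, covec_comp A c q \<xi>)"
  by (auto simp: cotangent_chart_def)

lemma inj_on_cotangent_chart:
  assumes "c \<in> A"
  shows "inj_on (snd (cotangent_chart A c)) (fst (cotangent_chart A c))"
proof (rule inj_onI, clarify)
  fix q q' \<xi> \<xi>'
  assume "(q, \<xi>) \<in> fst (cotangent_chart A c)" "(q', \<xi>') \<in> fst (cotangent_chart A c)"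
    "snd (cotangent_chart A c) (q, \<xi>) = snd (cotangent_chart A c) (q', \<xi>')"
  then have *: "q \<in> fst c" "\<xi> \<in> cotangent_space A q" "q' \<in> fst c" "\<xi>' \<in> cotangent_space A q'"
    "snd c q = snd c q'" "covec_comp A c q \<xi> = covec_comp A c q' \<xi>'"
    by simp_all
  then have q: "q = q'" using inj_on_chart[OF assms] by (auto simp: inj_on_def)
  with * have "\<xi> = \<xi>'"
    using inj_onD[OF inj_on_covec_comp[OF charts_atI[OF assms *(1)]]] by auto
  with q show "q = q' \<and> \<xi> = \<xi>'" by simp
qed

text \<open>By \<open>surj_covec_comp\<close> every vector is the momentum of a covector at each
  point, so the fibres are full.\<close>

lemma cotangent_chart_overlap:
  assumes "c \<in> A"
  shows "snd (cotangent_chart A c) ` (fst (cotangent_chart A c) \<inter> fst (cotangent_chart A c')) =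
    (snd c ` (fst c \<inter> fst c')) \<times> UNIV" (is "?L = ?R")
proof (rule set_eqI)
  fix y :: "'e \<times> 'e"
  obtain x p where y: "y = (x, p)" by (metis prod.collapse)
  show "y \<in> ?L \<longleftrightarrow> y \<in> ?R"
  proof
    assume "y \<in> ?L"
    then show "y \<in> ?R" by (auto simp: cotangent_chart_def)
  next
    assume "y \<in> ?R"
    then obtain q where q: "q \<in> fst c" "q \<in> fst c'" "x = snd c q" using y by auto
    obtain \<xi> where \<xi>: "\<xi> \<in> cotangent_space A q" "p = covec_comp A c q \<xi>"
      using surj_covec_comp[OF charts_atI[OF assms q(1)]] by (metis UNIV_I imageE)
    show "y \<in> ?L"
      by (rule image_eqI[of _ _ "(q, \<xi>)"]) (use q \<xi> y in auto)
  qed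
qed

text \<open>The base block of the derivative is recorded exactly. Of the momentum block only
  existence is recorded; what is wanted of it later comes from differentiating
  \<open>covec_comp_jacobian\<close>.\<close>

lemma cotangent_transition_has_derivative:
  assumes "c \<in> A" "c' \<in> A" "z \<in> fst (cotangent_chart A c)" "z \<in> fst (cotangent_chart A c')"
  obtains J where "((snd (cotangent_chart A c') \<circ> chart_inv (cotangent_chart A c)) has_derivative
      (\<lambda>u. (jacobian c c' (fst z) (fst u), J u))) (at (snd (cotangent_chart A c) z))"
proof -
  obtain q \<xi> where z: "z = (q, \<xi>)" by (metis prod.collapse)
  have c: "c \<in> charts_at A q" and c': "c' \<in> charts_at A q"
    using assms z by (auto simp: charts_at_def)
  let ?\<phi> = "snd c' \<circ> chart_inv c" and ?\<psi> = "snd c \<circ> chart_inv c'"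
  \<comment> \<open>The momentum transition of \<open>covec_comp_transition\<close> as a function on
    the model space, with the Jacobian taken at the moving base point.\<close>
  let ?g = "\<lambda>y. riesz B (\<lambda>b. snd y \<bullet> frechet_derivative ?\<psi> (at (?\<phi> (fst y))) b)"
  have \<phi>: "((\<lambda>y. ?\<phi> (fst y)) has_derivative (\<lambda>u. jacobian c c' q (fst u))) (at (snd c q, p))" for p :: 'e
    by (rule has_derivative_compose[OF has_derivative_fst[OF has_derivative_ident]])
      (use has_derivative_jacobian[OF c c'] in \<open>simp add: o_def\<close>)
  have \<phi>q: "?\<phi> (snd c q) = snd c' q" using c by (auto dest!: charts_atD)
  have "(\<lambda>y. snd y \<bullet> frechet_derivative ?\<psi> (at (?\<phi> (fst y))) b) differentiable (at (snd c q, p))" for b p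
  proof -
    \<comment> \<open>Second derivatives of the base transition are used here.\<close>
    have "(\<lambda>x. frechet_derivative ?\<psi> (at x) b) differentiable (at (snd c' q))"
      using smooth_on_derivative[OF smooth_transition[OF assms(2,1)]] c c'
      by (auto intro!: smooth_on_imp_differentiable dest!: charts_atD)
    then have "(\<lambda>y. frechet_derivative ?\<psi> (at (?\<phi> (fst y))) b) differentiable (at (snd c q, p))"
      using differentiable_compose[of "\<lambda>x. frechet_derivative ?\<psi> (at x) b" "\<lambda>y. ?\<phi> (fst y)" "(snd c q, p)"]
        differentiableI[OF \<phi>] \<phi>q by (simp add: o_def)
    moreover have "snd differentiable (at (snd c q, p))"
      by (rule bounded_linear_imp_differentiable[OF bounded_linear_snd])
    ultimately show ?thesis by simp
  qed
  then have "?g differentiable (at (snd c q, p))" for p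
    unfolding riesz_def using finite_basis by (intro differentiable_sum differentiable_scaleR) auto
  then obtain J where J: "(?g has_derivative J) (at (snd c q, covec_comp A c q \<xi>))"
    by (meson differentiable_def)
  have "((snd (cotangent_chart A c') \<circ> chart_inv (cotangent_chart A c)) has_derivative
      (\<lambda>u. (jacobian c c' q (fst u), J u))) (at (snd c q, covec_comp A c q \<xi>))"
  proof (rule has_derivative_transform_within_open)
    show "((\<lambda>y. (?\<phi> (fst y), ?g y)) has_derivative (\<lambda>u. (jacobian c c' q (fst u), J u)))
        (at (snd c q, covec_comp A c q \<xi>))"
      by (rule has_derivative_Pair[OF \<phi> J])
    show "open ((snd c ` (fst c \<inter> fst c')) \<times> (UNIV :: 'e set))"
      using open_overlap[OF assms(1,2)] by (simp add: open_Times)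
    show "(snd c q, covec_comp A c q \<xi>) \<in> (snd c ` (fst c \<inter> fst c')) \<times> UNIV"
      using assms z by auto
    show "(?\<phi> (fst y), ?g y) = (snd (cotangent_chart A c') \<circ> chart_inv (cotangent_chart A c)) y"
      if "y \<in> (snd c ` (fst c \<inter> fst c')) \<times> (UNIV :: 'e set)" for y
    proof -
      from that obtain w where w: "w \<in> fst (cotangent_chart A c)" "w \<in> fst (cotangent_chart A c')"
        "y = snd (cotangent_chart A c) w"
        using cotangent_chart_overlap[OF assms(1)] by blast
      obtain q' \<xi>' where w': "w = (q', \<xi>')" by (metis prod.collapse)
      have c: "c \<in> charts_at A q'" and c': "c' \<in> charts_at A q'" and \<xi>': "\<xi>' \<in> cotangent_space A q'"
        using w w' assms by (auto simp: charts_at_def)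
      have "chart_inv (cotangent_chart A c) y = w"
        unfolding w(3) chart_inv_def by (rule inv_into_f_f[OF inj_on_cotangent_chart[OF assms(1)] w(1)])
      moreover have "?\<phi> (snd c q') = snd c' q'" using c by (auto dest!: charts_atD)
      ultimately show ?thesis
        using covec_comp_transition[OF c c' \<xi>'] w(3) w' by (simp add: jacobian_def o_def)
    qed
  qed
  then show ?thesis using that z by simp
qed

sublocale cot: differentiable_atlas "cotangent_atlas A"
proof (unfold_locales; (unfold cotangent_atlas_def, elim imageE; hypsubst))
  show "inj_on (snd (cotangent_chart A c)) (fst (cotangent_chart A c))" if "c \<in> A" for c
    by (rule inj_on_cotangent_chart[OF that])
  show "open (snd (cotangent_chart A c) ` (fst (cotangent_chart A c) \<inter> fst (cotangent_chart A c')))"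
    if "c \<in> A" "c' \<in> A" for c c'
    unfolding cotangent_chart_overlap[OF that(1)] using open_overlap[OF that] by (simp add: open_Times)
  show "(snd (cotangent_chart A c') \<circ> chart_inv (cotangent_chart A c)) differentiable
      at (snd (cotangent_chart A c) z)"
    if "z \<in> fst (cotangent_chart A c)" "z \<in> fst (cotangent_chart A c')" "c \<in> A" "c' \<in> A" for c c' z
    by (rule cotangent_transition_has_derivative[OF that(3,4,1,2)]) (rule differentiableI)
qed

lemma phase_atlas_eq: "phase_atlas A = times_chart ` cotangent_atlas A"
  by (auto simp: phase_atlas_def times_chart_def)

sublocale P: differentiable_atlas "phase_atlas A"
  unfolding phase_atlas_eq by (rule cot.differentiable_atlas_times)


section \<open>Contact geometry on the phase space\<close>

lemma phase_chart_simps [simp]: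
  "((q, \<xi>), r) \<in> fst (phase_chart A c) \<longleftrightarrow> q \<in> fst c \<and> \<xi> \<in> cotangent_space A q"
  "snd (phase_chart A c) ((q, \<xi>), r) = ((snd c q, covec_comp A c q \<xi>), r)"
  by (simp_all add: phase_chart_def)

lemma phase_charts_atE:
  assumes "k \<in> charts_at (phase_atlas A) z"
  obtains c where "k = phase_chart A c" "c \<in> charts_at A (fst (fst z))"
    "snd (fst z) \<in> cotangent_space A (fst (fst z))"
    "cotangent_chart A c \<in> charts_at (cotangent_atlas A) (fst z)"
proof -
  obtain c where c: "k = phase_chart A c" "c \<in> A" "z \<in> fst (phase_chart A c)"
    using assms by (auto simp: charts_at_def phase_atlas_eq cotangent_atlas_def phase_chart_def)
  obtain q \<xi> r where z: "z = ((q, \<xi>), r)" by (metis prod.collapse)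
  show ?thesis
    using that[of c] c unfolding z by (auto simp: charts_at_def cotangent_atlas_def)
qed

lemma phase_jacobian:
  assumes "phase_chart A c \<in> charts_at (phase_atlas A) z" "phase_chart A c' \<in> charts_at (phase_atlas A) z"
    and "c \<in> charts_at A (fst (fst z))" "c' \<in> charts_at A (fst (fst z))"
    and "snd (fst z) \<in> cotangent_space A (fst (fst z))"
  shows "fst (fst (jacobian (phase_chart A c) (phase_chart A c') z u)) =
      jacobian c c' (fst (fst z)) (fst (fst u))"
    and "snd (jacobian (phase_chart A c) (phase_chart A c') z u) = snd u"
proof -
  obtain q \<xi> r where z: "z = ((q, \<xi>), r)" by (metis prod.collapse)
  have k: "cotangent_chart A c \<in> charts_at (cotangent_atlas A) (q, \<xi>)"
    "cotangent_chart A c' \<in> charts_at (cotangent_atlas A) (q, \<xi>)"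
    using assms z by (auto simp: charts_at_def cotangent_atlas_def)
  note J = cot.jacobian_times[OF k, of r u, folded phase_chart_def]
  show "snd (jacobian (phase_chart A c) (phase_chart A c') z u) = snd u"
    unfolding z J by simp
  have cA: "c \<in> A" "c' \<in> A" "(q, \<xi>) \<in> fst (cotangent_chart A c)" "(q, \<xi>) \<in> fst (cotangent_chart A c')"
    using assms z by (auto simp: charts_at_def)
  obtain L where L: "((snd (cotangent_chart A c') \<circ> chart_inv (cotangent_chart A c)) has_derivative
      (\<lambda>u. (jacobian c c' q (fst u), L u))) (at (snd (cotangent_chart A c) (q, \<xi>)))"
    using cotangent_transition_has_derivative[OF cA] by auto
  have "jacobian (cotangent_chart A c) (cotangent_chart A c') (q, \<xi>) = (\<lambda>u. (jacobian c c' q (fst u), L u))"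
    using has_derivative_unique[OF cot.has_derivative_jacobian[OF k] L] .
  then show "fst (fst (jacobian (phase_chart A c) (phase_chart A c') z u)) =
      jacobian c c' (fst (fst z)) (fst (fst u))"
    unfolding z J by simp
qed

text \<open>The Jacobian is linear on the cotangent part and the identity on \<open>S\<close> and
  \<open>t\<close>, so it fixes \<open>(0, r)\<close>. Both \<open>reeb\<close> and
  \<open>partial_t\<close> are of this shape.\<close>

lemma constant_phase_vector:
  assumes "k \<in> charts_at (phase_atlas A) z"
  shows "(\<lambda>k. if k \<in> charts_at (phase_atlas A) z then (0, r) else 0) \<in> tangent_space (phase_atlas A) z"
proof (rule P.tangent_spaceI)
  fix k k' assume k: "k \<in> charts_at (phase_atlas A) z" "k' \<in> charts_at (phase_atlas A) z"
  obtain c where c: "k = phase_chart A c" "cotangent_chart A c \<in> charts_at (cotangent_atlas A) (fst z)"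
    using phase_charts_atE[OF k(1)] by metis
  obtain c' where c': "k' = phase_chart A c'" "cotangent_chart A c' \<in> charts_at (cotangent_atlas A) (fst z)"
    using phase_charts_atE[OF k(2)] by metis
  have "jacobian k k' z (0, r) = (0, r)"
    using cot.jacobian_times[OF c(2) c'(2), of "snd z" "(0, r)"] linear_0[OF cot.linear_jacobian[OF c(2) c'(2)]]
    by (simp add: c(1) c'(1) phase_chart_def)
  then show "(if k' \<in> charts_at (phase_atlas A) z then (0, r) else 0) =
      jacobian k k' z (if k \<in> charts_at (phase_atlas A) z then (0, r) else 0)"
    using k by simp
qed simp

lemma reeb_in_tangent_space:
  "k \<in> charts_at (phase_atlas A) z \<Longrightarrow> reeb A z \<in> tangent_space (phase_atlas A) z"
  using constant_phase_vector[of k z "(1, 0)"] by (simp add: reeb_def[abs_def] zero_prod_def cong: if_cong)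

lemma partial_t_in_tangent_space:
  "k \<in> charts_at (phase_atlas A) z \<Longrightarrow> partial_t A z \<in> tangent_space (phase_atlas A) z"
  using constant_phase_vector[of k z "(0, 1)"] by (simp add: partial_t_def[abs_def] zero_prod_def cong: if_cong)

section \<open>Coordinate expressions of the contact forms\<close>

lemma snd_chart_inv_phase:
  assumes "k \<in> phase_atlas A" "y \<in> snd k ` fst k"
  shows "snd (chart_inv k y) = snd y"
proof -
  obtain z where z: "z \<in> fst k" "y = snd k z" using assms(2) by blast
  obtain d where "k = times_chart d" using assms(1) by (auto simp: phase_atlas_eq)
  then show ?thesis using z P.chart_inv_chart[OF assms(1) z(1)] by (cases z) simp
qed

text \<open>The projection \<open>l\<close> serves to treat \<open>S_coord\<close> and
  \<open>t_coord\<close> together.\<close>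

lemma differential_of_snd:
  fixes l :: "real \<times> real \<Rightarrow> real"
  assumes "k \<in> charts_at (phase_atlas A) z" "v \<in> tangent_space (phase_atlas A) z" "bounded_linear l"
  shows "differential (phase_atlas A) (\<lambda>z. l (snd z)) z v = l (snd (v k))"
proof -
  have D: "(((\<lambda>z. l (snd z)) \<circ> chart_inv k) has_derivative (\<lambda>v. l (snd v))) (at (snd k z))"
    if "k \<in> charts_at (phase_atlas A) z" for k
  proof (rule has_derivative_transform_within_open)
    show "((\<lambda>y::'e phase_model. l (snd y)) has_derivative (\<lambda>v. l (snd v))) (at (snd k z))"
      by (intro bounded_linear_imp_has_derivative bounded_linear_compose[OF assms(3)] bounded_linear_snd)
    show "open (snd k ` fst k)" "snd k z \<in> snd k ` fst k"
      using that P.charts_atD P.open_chart_image by blast+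
    show "l (snd y) = ((\<lambda>z. l (snd z)) \<circ> chart_inv k) y" if "y \<in> snd k ` fst k" for y
      using snd_chart_inv_phase that P.charts_atD[OF \<open>k \<in> charts_at _ _\<close>] by simp
  qed
  show ?thesis
    using P.differential_chart[OF assms(1,2), of "\<lambda>z. l (snd z)"] differentiableI[OF D]
      fun_cong[OF frechet_derivative_at[OF D[OF assms(1)]], of "v k"] by simp
qed

lemma differential_S_coord:
  assumes "k \<in> charts_at (phase_atlas A) z" "v \<in> tangent_space (phase_atlas A) z"
  shows "differential (phase_atlas A) S_coord z v = fst (snd (v k))"
  using differential_of_snd[OF assms bounded_linear_fst] by (simp add: S_coord_def[abs_def])

lemma differential_t_coord:
  assumes "k \<in> charts_at (phase_atlas A) z" "v \<in> tangent_space (phase_atlas A) z"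
  shows "differential (phase_atlas A) t_coord z v = snd (snd (v k))"
  using differential_of_snd[OF assms bounded_linear_snd] by (simp add: t_coord_def[abs_def])

lemma chart_inv_cotangent:
  assumes "c \<in> A" "y \<in> snd (cotangent_chart A c) ` fst (cotangent_chart A c)"
  shows "snd c (fst (chart_inv (cotangent_chart A c) y)) = fst y"
proof -
  obtain w where w: "w \<in> fst (cotangent_chart A c)" "y = snd (cotangent_chart A c) w" using assms(2) by blast
  then have "chart_inv (cotangent_chart A c) y = w"
    using cot.chart_inv_chart assms(1) by (simp add: cotangent_atlas_def)
  then show ?thesis using w by (cases w) simp
qed

lemma chart_inv_phase:
  assumes "c \<in> A" "y \<in> snd (phase_chart A c) ` fst (phase_chart A c)"
  shows "snd (cotangent_chart A c) (fst (chart_inv (phase_chart A c) y)) = fst y"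
proof -
  obtain w where w: "w \<in> fst (phase_chart A c)" "y = snd (phase_chart A c) w" using assms(2) by blast
  then have "chart_inv (phase_chart A c) y = w"
    using P.chart_inv_chart assms(1) by (simp add: phase_atlas_eq cotangent_atlas_def phase_chart_def)
  then show ?thesis using w by (cases w) (simp add: phase_chart_def)
qed

text \<open>In adapted charts both bundle projections are \<open>fst\<close>, so the projected
  vector has the components \<open>fst (fst (v k))\<close>, and the covector evaluates it by the
  inner product with the momentum.\<close>

lemma liouville_pullback_coord:
  assumes "k \<in> charts_at (phase_atlas A) z" "v \<in> tangent_space (phase_atlas A) z"
  shows "pullback (phase_atlas A) (cotangent_atlas A) fst (liouville A) z v =
    snd (fst (snd k z)) \<bullet> fst (fst (v k))"
proof -
  obtain c where c: "k = phase_chart A c" "c \<in> charts_at A (fst (fst z))"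
    "snd (fst z) \<in> cotangent_space A (fst (fst z))"
    "cotangent_chart A c \<in> charts_at (cotangent_atlas A) (fst z)"
    using phase_charts_atE[OF assms(1)] by metis
  have cA: "c \<in> A" using c(2) charts_atD by blast
  obtain q \<xi> r where z: "z = ((q, \<xi>), r)" by (metis prod.collapse)
  have "((snd (cotangent_chart A c) \<circ> fst \<circ> chart_inv k) has_derivative fst) (at (snd k z))"
  proof (rule has_derivative_transform_within_open)
    show "(fst has_derivative fst) (at (snd k z))"
      by (rule bounded_linear_imp_has_derivative[OF bounded_linear_fst])
    show "open (snd k ` fst k)" "snd k z \<in> snd k ` fst k"
      using assms(1) P.charts_atD P.open_chart_image by blast+
    show "fst y = (snd (cotangent_chart A c) \<circ> fst \<circ> chart_inv k) y" if "y \<in> snd k ` fst k" for y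
      using chart_inv_phase[OF cA] that c(1) by simp
  qed
  then have 1: "tangent_map (phase_atlas A) (cotangent_atlas A) fst z v =
      coord_vec (cotangent_atlas A) (cotangent_chart A c) (fst z) (fst (v k))"
    using P.tangent_map_eq_coord_vec[where f = fst, OF cot.differentiable_atlas_axioms assms(1) c(4) assms(2)]
      c(1) by (auto simp: phase_chart_def times_chart_def)
  have "((snd c \<circ> fst \<circ> chart_inv (cotangent_chart A c)) has_derivative fst) (at (snd (cotangent_chart A c) (fst z)))"
  proof (rule has_derivative_transform_within_open)
    show "(fst has_derivative fst) (at (snd (cotangent_chart A c) (fst z)))"
      by (rule bounded_linear_imp_has_derivative[OF bounded_linear_fst])
    show "open (snd (cotangent_chart A c) ` fst (cotangent_chart A c))"
      "snd (cotangent_chart A c) (fst z) \<in> snd (cotangent_chart A c) ` fst (cotangent_chart A c)"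
      using c(4) cot.charts_atD cot.open_chart_image by blast+
    show "fst y = (snd c \<circ> fst \<circ> chart_inv (cotangent_chart A c)) y"
      if "y \<in> snd (cotangent_chart A c) ` fst (cotangent_chart A c)" for y
      using chart_inv_cotangent[OF cA] that by simp
  qed
  then have 2: "tangent_map (cotangent_atlas A) A fst (fst z)
      (coord_vec (cotangent_atlas A) (cotangent_chart A c) (fst z) (fst (v k))) =
      coord_vec A c (fst (fst z)) (fst (fst (v k)))"
    using cot.tangent_map_eq_coord_vec[where f = fst and D = fst, OF differentiable_atlas_axioms c(4) c(2)
        cot.coord_vec_in_tangent_space[OF c(4), of "fst (v k)"]] c(4)
    by (auto simp: cotangent_chart_def)
  have "snd (fst z) (coord_vec A c (fst (fst z)) (fst (fst (v k)))) = covec_comp A c q \<xi> \<bullet> fst (fst (v k))"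
    using covec_comp_inner[of c q \<xi>] c z by simp
  then show ?thesis
    unfolding pullback_def liouville_def 1 2 using z c(1) by simp
qed

lemma contact_form_coord:
  assumes "k \<in> charts_at (phase_atlas A) z" "v \<in> tangent_space (phase_atlas A) z"
  shows "contact_form A z v = contact_coord (snd k z) (v k)"
  unfolding contact_form_def contact_coord_def
  using differential_S_coord[OF assms] liouville_pullback_coord[OF assms] by simp

lemma ext_contact_form_coord:
  assumes "k \<in> charts_at (phase_atlas A) z" "v \<in> tangent_space (phase_atlas A) z"
  shows "ext_contact_form A h z v = ext_contact_coord (h \<circ> chart_inv k) (snd k z) (v k)"
  unfolding ext_contact_form_def ext_contact_coord_def
  using contact_form_coord[OF assms] differential_t_coord[OF assms] P.charts_atD[OF assms(1)] by simp

lemma form_comp_contact: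
  assumes "k \<in> phase_atlas A" "y \<in> snd k ` fst k"
  shows "form_comp (phase_atlas A) (contact_form A) k y u = contact_coord y u"
    and "form_comp (phase_atlas A) (ext_contact_form A h) k y u = ext_contact_coord (h \<circ> chart_inv k) y u"
proof -
  obtain z where z: "z \<in> fst k" "y = snd k z" using assms(2) by blast
  then have k: "k \<in> charts_at (phase_atlas A) z" using assms(1) by (simp add: charts_at_def)
  have inv: "chart_inv k y = z" using z assms(1) P.chart_inv_chart by simp
  note u = P.coord_vec_in_tangent_space[OF k, of u]
  show "form_comp (phase_atlas A) (contact_form A) k y u = contact_coord y u"
    unfolding form_comp_def inv contact_form_coord[OF k u] P.coord_vec_same[OF k] using z(2) by simp
  show "form_comp (phase_atlas A) (ext_contact_form A h) k y u = ext_contact_coord (h \<circ> chart_inv k) y u"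
    unfolding form_comp_def inv ext_contact_form_coord[OF k u] P.coord_vec_same[OF k] using z(2) by simp
qed

text \<open>
  The identity \<open>p' \<bullet> D\<phi>(q) u = p \<bullet> u\<close> characterises the momentum in the new chart. Its derivative
  contains the second derivative of \<open>\<phi>\<close>, whose symmetry makes it cancel in the symplectic form.
\<close>

lemma symplectic_coord_chart_independent:
  assumes k: "k \<in> charts_at (phase_atlas A) z" and k': "k' \<in> charts_at (phase_atlas A) z"
    and v: "v \<in> tangent_space (phase_atlas A) z" and w: "w \<in> tangent_space (phase_atlas A) z"
  shows "symplectic_coord (v k') (w k') = symplectic_coord (v k) (w k)"
proof -
  obtain c where c: "k = phase_chart A c" "c \<in> charts_at A (fst (fst z))"
    "snd (fst z) \<in> cotangent_space A (fst (fst z))"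
    using phase_charts_atE[OF k] by metis
  obtain c' where c': "k' = phase_chart A c'" "c' \<in> charts_at A (fst (fst z))"
    using phase_charts_atE[OF k'] by metis
  have cA: "c \<in> A" "c' \<in> A" using c(2) c'(2) charts_atD by auto
  obtain q \<xi> r where z: "z = ((q, \<xi>), r)" by (metis prod.collapse)
  have kA: "k \<in> phase_atlas A" "k' \<in> phase_atlas A" using k k' P.charts_atD by blast+
  define \<phi> where "\<phi> = snd c' \<circ> chart_inv c"
  define \<tau> where "\<tau> = snd k' \<circ> chart_inv k"
  define J where "J = jacobian k k' z"
  define U where "U = snd c ` (fst c \<inter> fst c')"
  define D2 where "D2 u v = frechet_derivative (\<lambda>x. frechet_derivative \<phi> (at x) u) (at (snd c q)) v" for u v
  have U: "open U" "snd c q \<in> U" using open_overlap[OF cA] c(2) c'(2) z by (auto simp: U_def charts_at_def)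
  have \<phi>: "smooth_on U \<phi>" using smooth_transition[OF cA] by (simp add: \<phi>_def U_def)
  have \<tau>: "(\<tau> has_derivative J) (at (snd k z))"
    using P.has_derivative_jacobian[OF k k'] by (simp add: \<tau>_def J_def)
  have J\<phi>: "fst (fst (J u)) = frechet_derivative \<phi> (at (snd c q)) (fst (fst u))" for u
    using phase_jacobian(1)[OF k[unfolded c(1)] k'[unfolded c'(1)] c(2) c'(2) c(3), of u] z
    by (simp add: J_def c(1) c'(1) jacobian_def \<phi>_def)
  have z_coord: "snd k z = ((snd c q, covec_comp A c q \<xi>), r)" using z c(1) by simp
  have \<tau>z: "\<tau> (snd k z) = snd k' z" using k by (auto simp: \<tau>_def dest!: P.charts_atD)
  define p' where "p' = snd (fst (snd k' z))"
  \<comment> \<open>Here \<open>snd (fst (J v))\<close> is the change of the new momentum along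
    \<open>v\<close>. The base point of the Jacobian moves as well, which gives the
    \<open>D2\<close> term.\<close>
  have D: "snd (fst (J v)) \<bullet> frechet_derivative \<phi> (at (snd c q)) u + p' \<bullet> D2 u (fst (fst v)) = snd (fst v) \<bullet> u"
    for u v
  proof -
    have "((\<lambda>x. frechet_derivative \<phi> (at x) u) has_derivative D2 u) (at (snd c q))"
      using smooth_on_imp_has_derivative[OF smooth_on_derivative[OF \<phi>] U(2)] by (simp add: D2_def[abs_def])
    then have "((\<lambda>y::'e phase_model. frechet_derivative \<phi> (at (fst (fst y))) u) has_derivative
        (\<lambda>v. D2 u (fst (fst v)))) (at (snd k z))"
      by (intro has_derivative_compose[where g = "\<lambda>x. frechet_derivative \<phi> (at x) u" and f = "\<lambda>y. fst (fst y)"])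
        (auto intro!: derivative_intros simp: z_coord)
    then have 1: "((\<lambda>y. snd (fst (\<tau> y)) \<bullet> frechet_derivative \<phi> (at (fst (fst y))) u) has_derivative
        (\<lambda>v. snd (fst (\<tau> (snd k z))) \<bullet> D2 u (fst (fst v)) +
          snd (fst (J v)) \<bullet> frechet_derivative \<phi> (at (fst (fst (snd k z)))) u)) (at (snd k z))"
      by (intro derivative_intros \<tau>)
    have 2: "snd (fst (\<tau> y)) \<bullet> frechet_derivative \<phi> (at (fst (fst y))) u = snd (fst y) \<bullet> u"
      if y: "y \<in> snd k ` (fst k \<inter> fst k')" for y
    proof -
      obtain w where w: "w \<in> fst k" "w \<in> fst k'" "y = snd k w" using y by blast
      obtain q1 \<xi>1 r1 where w1: "w = ((q1, \<xi>1), r1)" by (metis prod.collapse)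
      have at1: "c \<in> charts_at A q1" "c' \<in> charts_at A q1" "\<xi>1 \<in> cotangent_space A q1"
        using w cA by (auto simp: w1 c(1) c'(1) charts_at_def)
      have "\<tau> y = snd k' w" using w kA by (simp add: \<tau>_def)
      then show ?thesis
        using covec_comp_jacobian[OF at1, of u] w(3)
        by (simp add: w1 c(1) c'(1) jacobian_def \<phi>_def)
    qed
    have in_overlap: "snd k z \<in> snd k ` (fst k \<inter> fst k')"
      using k k' P.charts_atD by blast
    have "((\<lambda>y. snd (fst y) \<bullet> u) has_derivative
        (\<lambda>v. snd (fst (\<tau> (snd k z))) \<bullet> D2 u (fst (fst v)) +
          snd (fst (J v)) \<bullet> frechet_derivative \<phi> (at (fst (fst (snd k z)))) u)) (at (snd k z))"
      by (rule has_derivative_transform_within_open[OF 1 P.open_overlap[OF kA] in_overlap 2])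
    moreover have "((\<lambda>y. snd (fst y) \<bullet> u) has_derivative (\<lambda>v. snd (fst v) \<bullet> u)) (at (snd k z))"
      by (auto intro!: derivative_eq_intros)
    ultimately have "(\<lambda>v. snd (fst (\<tau> (snd k z))) \<bullet> D2 u (fst (fst v)) +
        snd (fst (J v)) \<bullet> frechet_derivative \<phi> (at (fst (fst (snd k z)))) u) = (\<lambda>v. snd (fst v) \<bullet> u)"
      by (rule has_derivative_unique)
    from fun_cong[OF this, of v] show ?thesis unfolding \<tau>z p'_def[symmetric] by (simp add: z_coord)
  qed
  have sym: "D2 u v = D2 v u" for u v
    using second_derivative_symmetric[OF U, of \<phi>] \<phi> by (simp add: D2_def smooth_on_def)
  have J: "v k' = J (v k)" "w k' = J (w k)"
    using P.tangent_space_jacobian[OF _ k k'] v w by (simp_all add: J_def)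
  show ?thesis
    using D[of "v k" "fst (fst (w k))"] D[of "w k" "fst (fst (v k))"] sym[of "fst (fst (v k))" "fst (fst (w k))"]
    by (simp add: J symplectic_coord_def J\<phi>)
qed

text \<open>The definition computes in \<open>chart_at\<close>, where differentiating
  \<open>dS - p dq\<close> gives the symplectic expression; its chart independence then allows an
  arbitrary chart.\<close>

lemma ext_deriv_contact_form:
  assumes k: "k \<in> charts_at (phase_atlas A) z"
    and v: "v \<in> tangent_space (phase_atlas A) z" and w: "w \<in> tangent_space (phase_atlas A) z"
  shows "ext_deriv (phase_atlas A) (contact_form A) z v w = symplectic_coord (v k) (w k)"
proof -
  define k0 where "k0 = chart_at (phase_atlas A) z"
  have "z \<in> points (phase_atlas A)" using k by (auto simp: points_def charts_at_def)
  then have k0: "k0 \<in> charts_at (phase_atlas A) z" unfolding k0_def by (rule P.chart_at_in)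
  have k0A: "k0 \<in> phase_atlas A" "snd k0 z \<in> snd k0 ` fst k0" using k0 P.charts_atD by blast+
  have D: "frechet_derivative (\<lambda>y. form_comp (phase_atlas A) (contact_form A) k0 y u) (at (snd k0 z)) =
      (\<lambda>v. - (snd (fst v) \<bullet> fst (fst u)))" for u
    using frechet_derivative_at[OF has_derivative_transform_within_open[OF has_derivative_contact_coord
          P.open_chart_image[OF k0A(1)] k0A(2) form_comp_contact(1)[OF k0A(1), symmetric]]] by metis
  have "ext_deriv (phase_atlas A) (contact_form A) z v w = symplectic_coord (v k0) (w k0)"
    unfolding ext_deriv_def k0_def[symmetric] Let_def D symplectic_coord_def by simp
  then show ?thesis using symplectic_coord_chart_independent[OF k k0 v w] by simp
qed

lemma phase_differential_coord:
  assumes "smooth_fun (phase_atlas A) F" "k \<in> charts_at (phase_atlas A) z" "v \<in> tangent_space (phase_atlas A) z"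
  shows "differential (phase_atlas A) F z v = frechet_derivative (F \<circ> chart_inv k) (at (snd k z)) (v k)"
  using P.differential_chart[OF assms(2,3)] P.smooth_fun_differentiable[OF assms(1)] by blast

lemma lie_fun_reeb:
  assumes "smooth_fun (phase_atlas A) F" "k \<in> charts_at (phase_atlas A) z"
  shows "lie_fun (phase_atlas A) (reeb A) F z =
    frechet_derivative (F \<circ> chart_inv k) (at (snd k z)) ((0, 0), (1, 0))"
  using phase_differential_coord[OF assms reeb_in_tangent_space[OF assms(2)]] assms(2)
  by (simp add: lie_fun_def reeb_def)

section \<open>Contact Hamiltonian and evolution vector fields\<close>

text \<open>Written in the chart \<open>k\<close>, the defining conditions become the system of
  \<open>ham_coord_unique\<close>, so the definite description selects the vector with components
  \<open>ham_coord\<close>.\<close>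

lemma contact_hamiltonian_vf_coord:
  assumes F: "smooth_fun (phase_atlas A) F" and k: "k \<in> charts_at (phase_atlas A) z"
  shows "contact_hamiltonian_vf A F z =
    coord_vec (phase_atlas A) k z (ham_coord B (F \<circ> chart_inv k) (snd k z))"
proof -
  let ?D = "frechet_derivative (F \<circ> chart_inv k) (at (snd k z))"
  have D: "((F \<circ> chart_inv k) has_derivative ?D) (at (snd k z))"
    using P.smooth_fun_differentiable[OF F k] by (simp add: frechet_derivative_works)
  have "v \<in> tangent_space (phase_atlas A) z \<and>
        differential (phase_atlas A) t_coord z v = 0 \<and>
        contact_form A z v = - F z \<and>
        (\<forall>w\<in>tangent_space (phase_atlas A) z.
           differential (phase_atlas A) t_coord z w = 0 \<longrightarrow>
           ext_deriv (phase_atlas A) (contact_form A) z v w =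
             differential (phase_atlas A) F z w
             - lie_fun (phase_atlas A) (reeb A) F z * contact_form A z w) \<longleftrightarrow>
      v = coord_vec (phase_atlas A) k z (ham_coord B (F \<circ> chart_inv k) (snd k z))" (is "?P v \<longleftrightarrow> ?Q v") for v
  proof (cases "v \<in> tangent_space (phase_atlas A) z")
    case True
    have "(\<forall>w\<in>tangent_space (phase_atlas A) z.
           differential (phase_atlas A) t_coord z w = 0 \<longrightarrow>
           ext_deriv (phase_atlas A) (contact_form A) z v w =
             differential (phase_atlas A) F z w
             - lie_fun (phase_atlas A) (reeb A) F z * contact_form A z w) \<longleftrightarrow>
        (\<forall>w\<in>tangent_space (phase_atlas A) z. snd (snd (w k)) = 0 \<longrightarrow>
          symplectic_coord (v k) (w k) = ?D (w k) - ?D ((0, 0), (1, 0)) * contact_coord (snd k z) (w k))"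
      using differential_t_coord[OF k] ext_deriv_contact_form[OF k True] phase_differential_coord[OF F k]
        lie_fun_reeb[OF F k] contact_form_coord[OF k] by (intro ball_cong) simp_all
    also have "\<dots> \<longleftrightarrow> (\<forall>u. snd (snd u) = 0 \<longrightarrow>
          symplectic_coord (v k) u = ?D u - ?D ((0, 0), (1, 0)) * contact_coord (snd k z) u)"
      by (rule P.ball_tangent_space[OF k])
    finally have "?P v \<longleftrightarrow> v k = ham_coord B (F \<circ> chart_inv k) (snd k z)"
      using True differential_t_coord[OF k True] contact_form_coord[OF k True] P.charts_atD[OF k]
      by (subst ham_coord_unique[OF D]) simp
    then show ?thesis using P.coord_vec_eq_iff[OF True k] by simp
  next
    case False
    then show ?thesis using P.coord_vec_in_tangent_space[OF k] by blast
  qed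
  then show ?thesis unfolding contact_hamiltonian_vf_def by simp
qed

lemma contact_hamiltonian_vf_in_tangent_space:
  assumes "smooth_fun (phase_atlas A) F" "k \<in> charts_at (phase_atlas A) z"
  shows "contact_hamiltonian_vf A F z \<in> tangent_space (phase_atlas A) z"
  using contact_hamiltonian_vf_coord[OF assms] P.coord_vec_in_tangent_space[OF assms(2)] by simp

lemma contact_hamiltonian_vf_apply:
  assumes "smooth_fun (phase_atlas A) F" "k \<in> charts_at (phase_atlas A) z"
  shows "contact_hamiltonian_vf A F z k = ham_coord B (F \<circ> chart_inv k) (snd k z)"
  using contact_hamiltonian_vf_coord[OF assms] P.coord_vec_same[OF assms(2)] by simp

lemma evolution_vf_in_tangent_space:
  assumes "smooth_fun (phase_atlas A) h" "k \<in> charts_at (phase_atlas A) z"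
  shows "evolution_vf A h z \<in> tangent_space (phase_atlas A) z"
  unfolding evolution_vf_def
  by (intro P.tangent_space_add contact_hamiltonian_vf_in_tangent_space[OF assms] partial_t_in_tangent_space[OF assms(2)])

lemma evolution_vf_apply:
  assumes "smooth_fun (phase_atlas A) h" "k \<in> charts_at (phase_atlas A) z"
  shows "evolution_vf A h z k = ham_coord B (h \<circ> chart_inv k) (snd k z) + ((0, 0), (0, 1))"
  using assms by (simp add: evolution_vf_def contact_hamiltonian_vf_apply partial_t_def)


section \<open>Generalized Noether symmetries\<close>

text \<open>Here \<open>k\<close> is the chart by which \<open>lie_form\<close> is defined; in it
  \<open>lie_ext_contact_coord\<close> applies to the local representative \<open>V\<close> of
  \<open>Y\<close>.\<close>

lemma lie_form_ext_contact_form: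
  fixes Y :: "('q, 'e) phase \<Rightarrow> (('q, 'e) phase, 'e phase_model) tvec"
  assumes Y: "vector_field (phase_atlas A) Y" and assoc: "associated_with A h Y F"
    and h: "smooth_fun (phase_atlas A) h" and F: "smooth_fun (phase_atlas A) F"
    and z: "z \<in> points (phase_atlas A)" and k: "k = chart_at (phase_atlas A) z"
  shows "lie_form (phase_atlas A) Y (ext_contact_form A h) z w =
    symplectic_coord (Y z k) (w k)
    + frechet_derivative (h \<circ> chart_inv k) (at (snd k z)) (Y z k) * snd (snd (w k))
    - snd (snd (Y z k)) * frechet_derivative (h \<circ> chart_inv k) (at (snd k z)) (w k)
    - frechet_derivative (F \<circ> chart_inv k) (at (snd k z)) (w k)"
proof -
  have k_at: "k \<in> charts_at (phase_atlas A) z" using P.chart_at_in[OF z] k by simp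
  then have kA: "k \<in> phase_atlas A" and kz: "snd k z \<in> snd k ` fst k" "z \<in> fst k"
    using P.charts_atD by blast+
  note U = P.open_chart_image[OF kA]
  define V where "V = (\<lambda>y. Y (chart_inv k y) k)"
  have V: "V differentiable (at (snd k z))"
    using Y kA kz unfolding vector_field_def V_def by (blast intro: smooth_on_imp_differentiable)
  have Vz: "V (snd k z) = Y z k" using P.chart_inv_chart[OF kA kz(2)] by (simp add: V_def)
  have D: "(f \<circ> chart_inv k has_derivative frechet_derivative (f \<circ> chart_inv k) (at (snd k z))) (at (snd k z))"
    if "smooth_fun (phase_atlas A) f" for f
    using P.smooth_fun_differentiable[OF that k_at] by (simp add: frechet_derivative_works)
  \<comment> \<open>The contraction condition at all points of the chart domain is an identity on an
    open set and can be differentiated.\<close>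
  have contr: "- ext_contact_coord (h \<circ> chart_inv k) y (V y) = (F \<circ> chart_inv k) y" if "y \<in> snd k ` fst k" for y
  proof -
    from that obtain x where x: "x \<in> fst k" "y = snd k x" by blast
    have x_at: "k \<in> charts_at (phase_atlas A) x" using x kA by (simp add: charts_at_def)
    have xp: "x \<in> points (phase_atlas A)" using x kA by (auto simp: points_def)
    have "chart_inv k y = x" using P.chart_inv_chart[OF kA x(1)] x(2) by simp
    moreover have "Y x \<in> tangent_space (phase_atlas A) x" using Y xp by (simp add: vector_field_def)
    moreover have "- ext_contact_form A h x (Y x) = F x"
      using assoc xp by (simp add: associated_with_def contract_def)
    ultimately show ?thesis
      using ext_contact_form_coord[OF x_at, of "Y x" h] x(2) by (simp add: V_def)
  qed
  have E: "frechet_derivative (\<lambda>y. form_comp (phase_atlas A) (ext_contact_form A h) k y (w k)) (at (snd k z)) =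
      frechet_derivative (\<lambda>y. ext_contact_coord (h \<circ> chart_inv k) y (w k)) (at (snd k z))"
  proof (rule frechet_derivative_transform_within_open[symmetric, OF _ U kz(1) form_comp_contact(2)[OF kA, symmetric]])
    show "(\<lambda>y. ext_contact_coord (h \<circ> chart_inv k) y (w k)) differentiable at (snd k z)"
      unfolding ext_contact_coord_def
      by (intro differentiable_add differentiable_mult differentiable_const
          differentiableI[OF has_derivative_contact_coord] differentiableI[OF D[OF h]])
  qed
  show ?thesis
    using lie_ext_contact_coord[OF U kz(1) V D[OF h] D[OF F] contr, of "w k"]
    unfolding lie_form_def k[symmetric] Let_def E form_comp_contact(2)[OF kA kz(1)] V_def[symmetric] Vz .
qed

lemma noether_symmetry_imp:
  fixes Y :: "('q, 'e) phase \<Rightarrow> (('q, 'e) phase, 'e phase_model) tvec"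
  assumes h: "smooth_fun (phase_atlas A) h" and F: "smooth_fun (phase_atlas A) F"
    and sym: "generalized_noether_symmetry A h Y" and assoc: "associated_with A h Y F"
  shows "\<exists>Yt. smooth_fun (phase_atlas A) Yt \<and>
      (\<forall>z\<in>points (phase_atlas A).
         Y z = (\<lambda>c. contact_hamiltonian_vf A F z c + Yt z *\<^sub>R evolution_vf A h z c))"
proof (intro exI conjI ballI)
  from sym obtain l where Y: "vector_field (phase_atlas A) Y"
    and l: "\<And>z w. z \<in> points (phase_atlas A) \<Longrightarrow> w \<in> tangent_space (phase_atlas A) z \<Longrightarrow>
      lie_form (phase_atlas A) Y (ext_contact_form A h) z w = l z * ext_contact_form A h z w"
    unfolding generalized_noether_symmetry_def by blast
  \<comment> \<open>The only possible coefficient: \<open>X_F\<close> has no t component, and that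
    of \<open>X_h^t\<close> is 1.\<close>
  define Yt where "Yt z = differential (phase_atlas A) t_coord z (Y z)" for z
  have Y_ts: "Y z \<in> tangent_space (phase_atlas A) z" if "z \<in> points (phase_atlas A)" for z
    using Y that by (simp add: vector_field_def)
  have Yt: "Yt z = snd (snd (Y z k))" if "k \<in> charts_at (phase_atlas A) z" for z k
  proof -
    have "z \<in> points (phase_atlas A)" using that by (auto simp: charts_at_def points_def)
    then show ?thesis unfolding Yt_def using differential_t_coord[OF that Y_ts] by simp
  qed
  show "smooth_fun (phase_atlas A) Yt"
    unfolding smooth_fun_def
  proof
    fix k assume k: "k \<in> phase_atlas A"
    note U = P.open_chart_image[OF k]
    show "smooth_on (snd k ` fst k) (Yt \<circ> chart_inv k)"
    proof (rule smooth_on_cong[OF U])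
      show "smooth_on (snd k ` fst k) (\<lambda>y. snd (snd (Y (chart_inv k y) k)))"
        using Y k unfolding vector_field_def
        by (intro smooth_on_comp_linear[OF bounded_linear_snd U]) blast
      show "snd (snd (Y (chart_inv k y) k)) = (Yt \<circ> chart_inv k) y" if "y \<in> snd k ` fst k" for y
        using that k P.chart_inv_chart[OF k] Yt[of k] by (auto simp: charts_at_def)
    qed
  qed
  fix z assume z: "z \<in> points (phase_atlas A)"
  define k where "k = chart_at (phase_atlas A) z"
  have k: "k \<in> charts_at (phase_atlas A) z" using P.chart_at_in[OF z] by (simp add: k_def)
  have D: "(f \<circ> chart_inv k has_derivative frechet_derivative (f \<circ> chart_inv k) (at (snd k z))) (at (snd k z))"
    if "smooth_fun (phase_atlas A) f" for f
    using P.smooth_fun_differentiable[OF that k] by (simp add: frechet_derivative_works)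
  have "\<forall>w\<in>tangent_space (phase_atlas A) z. symplectic_coord (Y z k) (w k)
    + frechet_derivative (h \<circ> chart_inv k) (at (snd k z)) (Y z k) * snd (snd (w k))
    - snd (snd (Y z k)) * frechet_derivative (h \<circ> chart_inv k) (at (snd k z)) (w k)
    - frechet_derivative (F \<circ> chart_inv k) (at (snd k z)) (w k) =
      l z * ext_contact_coord (h \<circ> chart_inv k) (snd k z) (w k)"
    using l[OF z] ext_contact_form_coord[OF k]
    by (auto simp: lie_form_ext_contact_form[OF Y assoc h F z k_def])
  \<comment> \<open>Every model vector is the component of some tangent vector, so the equation
    holds for all \<open>u\<close>.\<close>
  then have sym: "symplectic_coord (Y z k) u
    + frechet_derivative (h \<circ> chart_inv k) (at (snd k z)) (Y z k) * snd (snd u)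
    - snd (snd (Y z k)) * frechet_derivative (h \<circ> chart_inv k) (at (snd k z)) u
    - frechet_derivative (F \<circ> chart_inv k) (at (snd k z)) u =
      l z * ext_contact_coord (h \<circ> chart_inv k) (snd k z) u" for u
    using P.coord_vec_in_tangent_space[OF k, of u] P.coord_vec_same[OF k, of u] by metis
  have contr: "ext_contact_coord (h \<circ> chart_inv k) (snd k z) (Y z k) = - (F \<circ> chart_inv k) (snd k z)"
    using assoc z ext_contact_form_coord[OF k Y_ts[OF z], of h] P.charts_atD[OF k]
    by (simp add: associated_with_def contract_def) (metis minus_minus)
  show "Y z = (\<lambda>c. contact_hamiltonian_vf A F z c + Yt z *\<^sub>R evolution_vf A h z c)"
  proof (rule P.tangent_space_eqI[OF Y_ts[OF z] _ k])
    show "(\<lambda>c. contact_hamiltonian_vf A F z c + Yt z *\<^sub>R evolution_vf A h z c) \<in> tangent_space (phase_atlas A) z"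
      by (intro P.tangent_space_add P.tangent_space_scaleR contact_hamiltonian_vf_in_tangent_space[OF F k]
          evolution_vf_in_tangent_space[OF h k])
    show "Y z k = contact_hamiltonian_vf A F z k + Yt z *\<^sub>R evolution_vf A h z k"
      unfolding contact_hamiltonian_vf_apply[OF F k] evolution_vf_apply[OF h k] Yt[OF k]
      by (rule noether_coord_necessary[OF D[OF h] D[OF F] sym contr])
  qed
qed

lemma noether_symmetryI:
  fixes Y :: "('q, 'e) phase \<Rightarrow> (('q, 'e) phase, 'e phase_model) tvec"
  assumes h: "smooth_fun (phase_atlas A) h" and F: "smooth_fun (phase_atlas A) F"
    and diss: "dissipated_quantity A h F"
    and Yt: "smooth_fun (phase_atlas A) Yt"
    and Y_eq: "\<And>z. z \<in> points (phase_atlas A) \<Longrightarrow>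
         Y z = (\<lambda>c. contact_hamiltonian_vf A F z c + Yt z *\<^sub>R evolution_vf A h z c)"
  shows "generalized_noether_symmetry A h Y \<and> associated_with A h Y F"
proof -
  have pts: "z \<in> points (phase_atlas A)" if "k \<in> charts_at (phase_atlas A) z" for k z
    using that by (auto simp: charts_at_def points_def)
  have Y_apply: "Y z k = ham_coord B (F \<circ> chart_inv k) (snd k z)
      + Yt z *\<^sub>R (ham_coord B (h \<circ> chart_inv k) (snd k z) + ((0, 0), (0, 1)))"
    if "k \<in> charts_at (phase_atlas A) z" for k z
    using Y_eq[OF pts[OF that]] contact_hamiltonian_vf_apply[OF F that] evolution_vf_apply[OF h that] by simp
  have Y_ts: "Y z \<in> tangent_space (phase_atlas A) z" if "k \<in> charts_at (phase_atlas A) z" for k z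
    unfolding Y_eq[OF pts[OF that]]
    by (intro P.tangent_space_add P.tangent_space_scaleR contact_hamiltonian_vf_in_tangent_space[OF F that]
        evolution_vf_in_tangent_space[OF h that])
  \<comment> \<open>Smoothness is checked chart by chart, which takes the formula for
    \<open>X_F\<close> and \<open>X_h^t\<close> in every chart and not just in
    \<open>chart_at\<close>.\<close>
  have Y: "vector_field (phase_atlas A) Y"
    unfolding vector_field_def
  proof (intro conjI ballI)
    show "Y z \<in> tangent_space (phase_atlas A) z" if "z \<in> points (phase_atlas A)" for z
      using Y_ts[OF P.chart_at_in[OF that]] .
    fix k assume k: "k \<in> phase_atlas A"
    note U = P.open_chart_image[OF k]
    show "smooth_on (snd k ` fst k) (\<lambda>y. Y (chart_inv k y) k)"
    proof (rule smooth_on_cong[OF U])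
      show "smooth_on (snd k ` fst k) (\<lambda>y. ham_coord B (F \<circ> chart_inv k) y
          + (Yt \<circ> chart_inv k) y *\<^sub>R (ham_coord B (h \<circ> chart_inv k) y + ((0, 0), (0, 1))))"
        using h F Yt k unfolding smooth_fun_def
        by (intro smooth_on_add smooth_on_scaleR smooth_on_ham_coord smooth_on_const U) blast+
      show "ham_coord B (F \<circ> chart_inv k) y
          + (Yt \<circ> chart_inv k) y *\<^sub>R (ham_coord B (h \<circ> chart_inv k) y + ((0, 0), (0, 1))) = Y (chart_inv k y) k"
        if "y \<in> snd k ` fst k" for y
        using that P.chart_inv_chart[OF k] Y_apply[of k] k by (auto simp: charts_at_def)
    qed
  qed
  have D: "(f \<circ> chart_inv k has_derivative frechet_derivative (f \<circ> chart_inv k) (at (snd k z))) (at (snd k z))"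
    if "smooth_fun (phase_atlas A) f" "k \<in> charts_at (phase_atlas A) z" for f k z
    using P.smooth_fun_differentiable[OF that] by (simp add: frechet_derivative_works)
  have diss_coord: "frechet_derivative (F \<circ> chart_inv k) (at (snd k z))
        (ham_coord B (h \<circ> chart_inv k) (snd k z) + ((0, 0), (0, 1))) =
      - frechet_derivative (h \<circ> chart_inv k) (at (snd k z)) ((0, 0), (1, 0)) * (F \<circ> chart_inv k) (snd k z)"
    if k: "k \<in> charts_at (phase_atlas A) z" for k z
    using diss pts[OF k] phase_differential_coord[OF F k evolution_vf_in_tangent_space[OF h k]]
      lie_fun_reeb[OF h k] P.charts_atD[OF k]
    by (simp add: dissipated_quantity_def lie_fun_def[of _ "evolution_vf A h"] evolution_vf_apply[OF h k])
  \<comment> \<open>Comes before the symmetry equation, because the formula for the Lie derivative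
    presupposes the contraction condition.\<close>
  have assoc: "associated_with A h Y F"
    unfolding associated_with_def contract_def
  proof
    fix z assume z: "z \<in> points (phase_atlas A)"
    note k = P.chart_at_in[OF z]
    show "- ext_contact_form A h z (Y z) = F z"
      using noether_coord_sufficient(2)[OF D[OF h k] D[OF F k] diss_coord[OF k] Y_apply[OF k]]
        ext_contact_form_coord[OF k Y_ts[OF k], of h] P.charts_atD[OF k] by simp
  qed
  \<comment> \<open>The multiplier of \<open>noether_coord_sufficient\<close>, with Reeb derivatives
    in place of partial derivatives in S, so that it is a function on the phase space.\<close>
  define l where "l z = - (Yt z * lie_fun (phase_atlas A) (reeb A) h z + lie_fun (phase_atlas A) (reeb A) F z)" for z
  have "smooth_fun (phase_atlas A) l"
    unfolding smooth_fun_def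
  proof
    fix k assume k: "k \<in> phase_atlas A"
    note U = P.open_chart_image[OF k]
    have s: "smooth_on (snd k ` fst k) (\<lambda>y. frechet_derivative (f \<circ> chart_inv k) (at y) ((0, 0), (1, 0)))"
      if "smooth_fun (phase_atlas A) f" for f
      using that k unfolding smooth_fun_def by (blast intro: smooth_on_derivative)
    show "smooth_on (snd k ` fst k) (l \<circ> chart_inv k)"
    proof (rule smooth_on_cong[OF U])
      show "smooth_on (snd k ` fst k) (\<lambda>y. - ((Yt \<circ> chart_inv k) y *\<^sub>R
            frechet_derivative (h \<circ> chart_inv k) (at y) ((0, 0), (1, 0))
          + frechet_derivative (F \<circ> chart_inv k) (at y) ((0, 0), (1, 0))))"
        using Yt k unfolding smooth_fun_def
        by (intro smooth_on_minus smooth_on_add smooth_on_scaleR s h F U) blast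
      show "- ((Yt \<circ> chart_inv k) y *\<^sub>R
            frechet_derivative (h \<circ> chart_inv k) (at y) ((0, 0), (1, 0))
          + frechet_derivative (F \<circ> chart_inv k) (at y) ((0, 0), (1, 0))) = (l \<circ> chart_inv k) y"
        if y: "y \<in> snd k ` fst k" for y
      proof -
        obtain z where z: "z \<in> fst k" "y = snd k z" using y by blast
        have kz: "k \<in> charts_at (phase_atlas A) z" using z k by (simp add: charts_at_def)
        show ?thesis
          using lie_fun_reeb[OF h kz] lie_fun_reeb[OF F kz] P.chart_inv_chart[OF k z(1)] by (simp add: l_def z(2))
      qed
    qed
  qed
  moreover have "lie_form (phase_atlas A) Y (ext_contact_form A h) z w = l z * ext_contact_form A h z w"
    if z: "z \<in> points (phase_atlas A)" and w: "w \<in> tangent_space (phase_atlas A) z" for z w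
  proof -
    note k = P.chart_at_in[OF z]
    show ?thesis
      using noether_coord_sufficient(1)[OF D[OF h k] D[OF F k] diss_coord[OF k] Y_apply[OF k],
          of "w (chart_at (phase_atlas A) z)"]
      unfolding lie_form_ext_contact_form[OF Y assoc h F z refl] ext_contact_form_coord[OF k w] l_def
        lie_fun_reeb[OF h k] lie_fun_reeb[OF F k] .
  qed
  ultimately show ?thesis
    unfolding generalized_noether_symmetry_def using Y assoc by blast
qed

end

section \<open>From a smooth manifold to its atlas\<close>

text \<open>The topology of \<open>X\<close> enters only here: charts are homeomorphisms onto open
  sets and have open domains, so overlaps have open images in the model space.\<close>

lemma smooth_manifold_imp_manifold_atlas:
  fixes A :: "('q, 'e::real_inner) chart set"
  assumes "smooth_manifold X A"
  obtains B where "manifold_atlas A B"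
proof -
  obtain B0 :: "'e set" where "finite B0" "span B0 = UNIV"
    using assms unfolding smooth_manifold_def by blast
  then obtain B :: "'e set" where B: "finite B" "\<And>u. u = (\<Sum>b\<in>B. (u \<bullet> b) *\<^sub>R b)"
    using finite_span_orthonormal_expansion by blast
  have top: "openin X (fst c)" "open (snd c ` fst c)"
      "homeomorphic_map (subtopology X (fst c)) (top_of_set (snd c ` fst c)) (snd c)" if "c \<in> A" for c
    using assms that unfolding smooth_manifold_def by blast+
  have smooth: "smooth_on (snd c ` (fst c \<inter> fst c')) (snd c' \<circ> chart_inv c)" if "c \<in> A" "c' \<in> A" for c c'
    using assms that unfolding smooth_manifold_def by blast
  have "manifold_atlas A B"
  proof
    show "inj_on (snd c) (fst c)" if "c \<in> A" for c
      using homeomorphic_imp_injective_map[OF top(3)[OF that]] openin_subset[OF top(1)[OF that]]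
      by (simp add: Int_absorb1)
    show "open (snd c ` (fst c \<inter> fst c'))" if "c \<in> A" "c' \<in> A" for c c'
    proof -
      have "openin (subtopology X (fst c)) (fst c \<inter> fst c')"
        using top(1)[OF that(2)] by (auto simp: openin_subtopology)
      then have "openin (top_of_set (snd c ` fst c)) (snd c ` (fst c \<inter> fst c'))"
        using homeomorphic_imp_open_map[OF top(3)[OF that(1)]] by (simp add: open_map_def)
      then show ?thesis using top(2)[OF that(1)] openin_open_eq by blast
    qed
    show "(snd c' \<circ> chart_inv c) differentiable at (snd c x)"
      if "c \<in> A" "c' \<in> A" "x \<in> fst c" "x \<in> fst c'" for c c' x
      using smooth_on_imp_differentiable[OF smooth[OF that(1,2)]] that by blast
  qed (use B smooth in auto)
  then show ?thesis using that by blast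
qed

theorem theorem4:
  fixes X :: "'q topology"
    and A :: "('q, 'e::real_inner) chart set"
    and h F :: "('q, 'e) phase \<Rightarrow> real"
    and Y :: "('q, 'e) phase \<Rightarrow> (('q, 'e) phase, 'e phase_model) tvec"
  assumes "smooth_manifold X A"
    and "smooth_fun (phase_atlas A) h"
    and "smooth_fun (phase_atlas A) F"
    and "dissipated_quantity A h F"
  shows "generalized_noether_symmetry A h Y \<and> associated_with A h Y F \<longleftrightarrow>
    (\<exists>Yt. smooth_fun (phase_atlas A) Yt \<and>
      (\<forall>z\<in>points (phase_atlas A).
         Y z = (\<lambda>c. contact_hamiltonian_vf A F z c + Yt z *\<^sub>R evolution_vf A h z c)))"
proof -
  obtain B where "manifold_atlas A B"
    using smooth_manifold_imp_manifold_atlas[OF assms(1)] .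
  then interpret manifold_atlas A B .
  show ?thesis
    using noether_symmetry_imp[OF assms(2,3)] noether_symmetryI[OF assms(2-4)] by blast
qed

end
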